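(* The constants $\delta_{\mathcal{H}}=\sup\{\delta\in[0,1/2] : \mathcal{H}(\delta)\text{ is true}\}$ and $\delta_{\mathcal{K}}=\sup\{\delta\in(0,1/2] : \mathcal{K}(\delta)\text{ is true}\}$ are equal: $\delta_{\mathcal{H}}=\delta_{\mathcal{K}}$.
   Context: All sets are assumed (Lebesgue) measurable; $\lambda$ is Lebesgue measure on $\mathbb{R}$. For $p\in\mathbb{R}$ and $\epsilon>0$, $I_\epsilon(p)=(p-\epsilon,p+\epsilon)$. For an interval $I$ of finite positive length $|I|$ and a measurable set $H\subset\mathbb{R}$, $\lambda(H|I)=\lambda(H\cap I)/|I|$. A measurable set $S\subset\mathbb{R}$ is nontrivial if neither $S$ nor $\mathbb{R}\setminus S$ has measure zero. For $0\le\delta\le 1/2$, a point $p\in\mathbb{R}$ is a $\delta$-exceptional point for $S$ if $$\delta\le\liminf_{\epsilon\to0^+}\lambda(S|I_\epsilon(p))\le\limsup_{\epsilon\to0^+}\lambda(S|I_\epsilon(p))\le 1-\delta .$$ For $0\le\delta\le1/2$, $\mathcal{H}(\delta)$ is the statement: there is a $\delta$-exceptional point for every nontrivial $S\subset\mathbb{R}$. A configuration is a set $C=(-\infty,0)\cup\bigcup_{i=1}^r(a_i,b_i)$, where $0<a_1<b_1<a_2<b_2<\dots<a_r<b_r$ is a finite increasing sequence of positive reals; the endpoints of $C$ are $0,a_1,b_1,\dots,a_r,b_r$. For $0\le\delta\le1/2$, $\mathcal{K}(\delta)$ is the statement: for every configuration $C$ there is an endpoint $c$ of $C$ such that $\delta\le\lambda(C|I_\omega(c))\le1-\delta$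 for all $\omega>0$. *)

theory Defs
  imports "HOL-Analysis.Analysis"
begin

definition nbhd :: "real \<Rightarrow> real \<Rightarrow> real set" where
  "nbhd \<epsilon> p = {p - \<epsilon> <..< p + \<epsilon>}"

definition density_in :: "real set \<Rightarrow> real set \<Rightarrow> real" where
  "density_in H I = measure lebesgue (H \<inter> I) / measure lebesgue I"

definition nontrivial :: "real set \<Rightarrow> bool" where
  "nontrivial S \<longleftrightarrow>
     S \<in> sets lebesgue \<and> emeasure lebesgue S \<noteq> 0 \<and> emeasure lebesgue (UNIV - S) \<noteq> 0"

text \<open>The densities are embedded into \<^typ>\<open>ereal\<close> because \<^const>\<open>Liminf\<close> and \<^const>\<open>Limsup\<close>
  require a complete lattice.\<close>

definition exceptional_point :: "real \<Rightarrow> real set \<Rightarrow> real \<Rightarrow> bool" where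
  "exceptional_point \<delta> S p \<longleftrightarrow>
     (let d = (\<lambda>\<epsilon>. ereal (density_in S (nbhd \<epsilon> p)))
      in ereal \<delta> \<le> Liminf (at_right 0) d \<and>
         Liminf (at_right 0) d \<le> Limsup (at_right 0) d \<and>
         Limsup (at_right 0) d \<le> ereal (1 - \<delta>))"

definition H_stmt :: "real \<Rightarrow> bool" where
  "H_stmt \<delta> \<longleftrightarrow> (\<forall>S. nontrivial S \<longrightarrow> (\<exists>p. exceptional_point \<delta> S p))"

text \<open>A configuration is given by the number \<open>r\<close> of its bounded components and by their
  endpoints \<open>a i\<close>, \<open>b i\<close> for \<open>1 \<le> i \<le> r\<close>; \<open>r = 0\<close> is allowed and the values of \<open>a\<close>, \<open>b\<close>
  outside \<open>{1..r}\<close> are irrelevant.\<close>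

definition config_data :: "nat \<Rightarrow> (nat \<Rightarrow> real) \<Rightarrow> (nat \<Rightarrow> real) \<Rightarrow> bool" where
  "config_data r a b \<longleftrightarrow>
     (1 \<le> r \<longrightarrow> 0 < a 1) \<and> (\<forall>i\<in>{1..r}. a i < b i) \<and> (\<forall>i\<in>{1..<r}. b i < a (Suc i))"

definition config :: "nat \<Rightarrow> (nat \<Rightarrow> real) \<Rightarrow> (nat \<Rightarrow> real) \<Rightarrow> real set" where
  "config r a b = {..<0} \<union> (\<Union>i\<in>{1..r}. {a i <..< b i})"

definition config_endpoints :: "nat \<Rightarrow> (nat \<Rightarrow> real) \<Rightarrow> (nat \<Rightarrow> real) \<Rightarrow> real set" where
  "config_endpoints r a b = {0} \<union> a ` {1..r} \<union> b ` {1..r}"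

definition K_stmt :: "real \<Rightarrow> bool" where
  "K_stmt \<delta> \<longleftrightarrow>
     (\<forall>r a b. config_data r a b \<longrightarrow>
        (\<exists>c\<in>config_endpoints r a b. \<forall>\<omega>>0.
           \<delta> \<le> density_in (config r a b) (nbhd \<omega> c) \<and>
           density_in (config r a b) (nbhd \<omega> c) \<le> 1 - \<delta>))"

definition delta_H :: real where
  "delta_H = Sup {\<delta>. 0 \<le> \<delta> \<and> \<delta> \<le> 1/2 \<and> H_stmt \<delta>}"

definition delta_K :: real where
  "delta_K = Sup {\<delta>. 0 < \<delta> \<and> \<delta> \<le> 1/2 \<and> K_stmt \<delta>}"

end

theory Submission
  imports Defs
begin

text \<open>Let \<open>0 < \<delta>\<close>. If \<open>K_stmt \<delta>\<close> holds and \<open>S\<close> is nontrivial, choose a window \<open>(x, y + h)\<close> in which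
  \<open>S\<close> is dense near the left end and sparse near the right end (or conversely, and then pass to the complement).
  The set that is full to the left of the window, empty to the right of it and equal to \<open>S\<close> inside is a limit of
  configurations, and a limit point \<open>p\<close> of their good end points is good for it at every scale. The
  choice of the window prevents \<open>p\<close> from being one of its ends, so \<open>p\<close> is \<open>\<delta>\<close>-exceptional for \<open>S\<close>.

  Conversely, let \<open>C\<close> be a configuration that violates \<open>K_stmt \<delta>'\<close>. Starting from a half-line, replace
  every end point again and again by a scaled copy of \<open>C\<close>, with scales that tend to \<open>0\<close> so fast that later
  changes do not matter for earlier scales. At each stage every point of the line has an extreme density on
  some scale: a point near an end point inherits the bad scale of that end point, and any other point
  sees density \<open>0\<close> or \<open>1\<close>. So the limit set has no \<open>\<delta>\<close>-exceptional point if \<open>\<delta>' < \<delta>\<close>.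

  Finally \<open>H_stmt (1/8)\<close> holds, so that the set defining \<open>delta_K\<close> is not empty (otherwise
  its supremum would be a junk value).\<close>

section \<open>Measure of a set in a window\<close>

abbreviation mes :: "real set \<Rightarrow> real \<Rightarrow> real \<Rightarrow> real" where
  "mes S u v \<equiv> measure lebesgue (S \<inter> {u<..<v})"

lemma lmeasurable_Int_interval:
  fixes S :: "real set"
  assumes "S \<in> sets lebesgue"
  shows "S \<inter> {u<..<v} \<in> lmeasurable"
  by (rule fmeasurable_Int_fmeasurable[OF _ assms, of "{u<..<v}", simplified Int_commute])
     (use lmeasurable_box[of u v] in simp)

lemma measure_diff_le:
  assumes "A \<in> fmeasurable M" "B \<in> fmeasurable M" "D \<in> fmeasurable M"
    and "A - B \<subseteq> D" "B - A \<subseteq> D"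
  shows "\<bar>measure M A - measure M B\<bar> \<le> measure M D"
proof -
  have "measure M X \<le> measure M Y + measure M D"
    if "X \<in> fmeasurable M" "Y \<in> fmeasurable M" "X - Y \<subseteq> D" for X Y
  proof -
    have "measure M X \<le> measure M (Y \<union> D)"
      using that assms by (intro measure_mono_fmeasurable) (auto intro: fmeasurable.Un)
    also have "\<dots> \<le> measure M Y + measure M D"
      using that assms by (intro measure_Un_le) auto
    finally show ?thesis .
  qed
  from this[of A B] this[of B A] show ?thesis using assms by linarith
qed

text \<open>The two windows differ only between \<open>u\<close> and \<open>u'\<close> and between
  \<open>v\<close> and \<open>v'\<close>. This remains true for empty windows, so no order of the
  end points is required.\<close>

lemma mes_lipschitz:
  assumes S: "S \<in> sets lebesgue"
  shows "\<bar>mes S u v - mes S u' v'\<bar> \<le> \<bar>u - u'\<bar> + \<bar>v - v'\<bar>"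
proof -
  let ?I = "{min u u'..max u u'}" and ?J = "{min v v'..max v v'}"
  have "\<bar>mes S u v - mes S u' v'\<bar> \<le> measure lebesgue (?I \<union> ?J)"
    by (intro measure_diff_le lmeasurable_Int_interval[OF S]) (auto intro: fmeasurable.Un)
  also have "\<dots> \<le> measure lebesgue ?I + measure lebesgue ?J"
    by (intro measure_Un_le) auto
  also have "\<dots> = \<bar>u - u'\<bar> + \<bar>v - v'\<bar>"
    by (auto simp: max_def min_def)
  finally show ?thesis .
qed

lemma continuous_on_mes_window:
  assumes "S \<in> sets lebesgue"
  shows "continuous_on A (\<lambda>u. mes S u (u + w))"
proof -
  have "2-lipschitz_on A (\<lambda>u. mes S u (u + w))"
  proof (rule lipschitz_onI)
    fix x y
    show "dist (mes S x (x + w)) (mes S y (y + w)) \<le> 2 * dist x y"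
      using mes_lipschitz[OF assms, of x "x + w" y "y + w"] by (simp add: dist_real_def)
  qed simp
  then show ?thesis by (rule lipschitz_on_continuous_on)
qed

lemma mes_bounds:
  assumes "S \<in> sets lebesgue" "u \<le> v"
  shows "mes S u v \<le> v - u"
proof -
  have "mes S u v \<le> measure lebesgue {u<..<v}"
    using assms by (intro measure_mono_fmeasurable) auto
  then show ?thesis using assms by simp
qed

lemma mes_mono:
  assumes "S \<in> sets lebesgue" "S \<inter> {u<..<v} \<subseteq> T \<inter> {u'<..<v'}" "T \<in> sets lebesgue"
  shows "mes S u v \<le> mes T u' v'"
  using assms by (intro measure_mono_fmeasurable lmeasurable_Int_interval) auto

lemma mes_add:
  assumes S: "S \<in> sets lebesgue" and "u \<le> v" "v \<le> w"
  shows "mes S u w = mes S u v + mes S v w"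
proof -
  let ?A = "S \<inter> {u<..<v}" and ?B = "S \<inter> {v<..<w}"
  have AB: "?A \<inter> ?B = {}" "?A \<in> lmeasurable" "?B \<in> lmeasurable"
    by (auto intro: lmeasurable_Int_interval[OF S])
  have "\<bar>mes S u w - measure lebesgue (?A \<union> ?B)\<bar> \<le> measure lebesgue {v..v}"
    using assms AB by (intro measure_diff_le lmeasurable_Int_interval[OF S] fmeasurable.Un lmeasurable_interval) auto
  moreover have "measure lebesgue (?A \<union> ?B) = mes S u v + mes S v w"
    using measure_Un3[OF AB(2,3)] AB(1) by simp
  ultimately show ?thesis by simp
qed

lemma mes_full: "u \<le> v \<Longrightarrow> {u<..<v} \<subseteq> S \<Longrightarrow> mes S u v = v - u"
  by (simp add: inf_absorb2)

lemma mes_empty: "{u<..<v} \<inter> S = {} \<Longrightarrow> mes S u v = 0"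
  by (simp add: Int_commute)

lemma mes_compl:
  assumes S: "S \<in> sets lebesgue" and "u \<le> v"
  shows "mes (- S) u v = (v - u) - mes S u v"
proof -
  have "- S \<inter> {u<..<v} = {u<..<v} - (S \<inter> {u<..<v})" by auto
  moreover have "measure lebesgue ({u<..<v} - (S \<inter> {u<..<v}))
      = measure lebesgue {u<..<v} - mes S u v"
    by (rule measurable_measure_Diff) (use S in \<open>auto intro: lmeasurable_Int_interval\<close>)
  ultimately show ?thesis using assms by simp
qed

text \<open>Inside the window, \<open>T\<close> is the copy of \<open>C\<close> scaled by
  \<open>\<eta>\<close>, reflected if \<open>s = - 1\<close>, with \<open>e\<close> moved to
  \<open>d\<close>. The correspondence is demanded only inside the window because refined sets agree
  with a copy of \<open>C\<close> only locally.\<close>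

lemma mes_affine:
  assumes C: "C \<in> sets lebesgue" and "0 < \<eta>" "s = 1 \<or> s = - 1"
    and T: "\<And>x. \<bar>x - d\<bar> < \<eta> * w \<Longrightarrow> x \<in> T \<longleftrightarrow> s * (x - d) / \<eta> + e \<in> C"
  shows "mes T (d - \<eta> * w) (d + \<eta> * w) = \<eta> * mes C (e - w) (e + w)"
proof -
  let ?f = "\<lambda>x. (s * \<eta>) *\<^sub>R x + (d - s * \<eta> * e)"
  have s: "s * s = 1" using assms by auto
  have "T \<inter> {d - \<eta> * w<..<d + \<eta> * w} = ?f ` (C \<inter> {e - w<..<e + w})"
  proof (intro set_eqI iffI)
    fix x assume "x \<in> T \<inter> {d - \<eta> * w<..<d + \<eta> * w}"
    then have x: "x \<in> T" "\<bar>x - d\<bar> < \<eta> * w" by auto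
    define y where "y = s * (x - d) / \<eta> + e"
    have "\<bar>y - e\<bar> = \<bar>x - d\<bar> / \<eta>" using assms by (auto simp: y_def)
    then have "\<eta> * \<bar>y - e\<bar> < \<eta> * w" using x \<open>0 < \<eta>\<close> by simp
    then have "\<bar>y - e\<bar> < w" using \<open>0 < \<eta>\<close> by simp
    moreover have "y \<in> C" using T x by (simp add: y_def)
    moreover have "x = ?f y" using \<open>0 < \<eta>\<close> s by (simp add: y_def field_simps)
    ultimately show "x \<in> ?f ` (C \<inter> {e - w<..<e + w})"
      by (intro image_eqI[of _ _ y]) auto
  next
    fix x assume "x \<in> ?f ` (C \<inter> {e - w<..<e + w})"
    then obtain y where y: "y \<in> C" "\<bar>y - e\<bar> < w" "x = ?f y" by auto
    have d: "x - d = s * \<eta> * (y - e)" using y by (simp add: algebra_simps)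
    have "\<bar>x - d\<bar> = \<eta> * \<bar>y - e\<bar>" unfolding d using assms by (auto simp: abs_mult)
    then have "\<bar>x - d\<bar> < \<eta> * w" using y \<open>0 < \<eta>\<close> by simp
    moreover have "s * (x - d) / \<eta> + e = y"
      using assms(2,3) y by (auto simp: diff_divide_distrib)
    ultimately show "x \<in> T \<inter> {d - \<eta> * w<..<d + \<eta> * w}" using T y by auto
  qed
  then have "mes T (d - \<eta> * w) (d + \<eta> * w) = \<bar>s * \<eta>\<bar> ^ DIM(real) * mes C (e - w) (e + w)"
    using measure_lebesgue_affine[of "s * \<eta>" "d - s * \<eta> * e" "C \<inter> {e - w<..<e + w}"]
    by (simp add: add.commute)
  then show ?thesis using assms by (auto simp: abs_mult)
qed

section \<open>Exceptional points and extreme densities\<close>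

lemma density_in_nbhd:
  assumes "0 < w"
  shows "density_in S (nbhd w p) = mes S (p - w) (p + w) / (2 * w)"
  using assms by (simp add: density_in_def nbhd_def)

lemma exceptional_pointI:
  assumes "0 < w0"
    and "\<And>w. 0 < w \<Longrightarrow> w < w0 \<Longrightarrow>
      \<delta> * (2 * w) \<le> mes S (p - w) (p + w) \<and> mes S (p - w) (p + w) \<le> (1 - \<delta>) * (2 * w)"
  shows "exceptional_point \<delta> S p"
proof -
  have ev: "\<forall>\<^sub>F w in at_right 0. w \<in> {0<..<w0}"
    using \<open>0 < w0\<close> by (rule eventually_at_right_real)
  have "\<forall>\<^sub>F w in at_right 0. ereal \<delta> \<le> ereal (density_in S (nbhd w p))"
    using ev by eventually_elim (use assms in \<open>auto simp: density_in_nbhd field_simps\<close>)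
  moreover have "\<forall>\<^sub>F w in at_right 0. ereal (density_in S (nbhd w p)) \<le> ereal (1 - \<delta>)"
    using ev by eventually_elim (use assms in \<open>auto simp: density_in_nbhd field_simps\<close>)
  ultimately show ?thesis
    unfolding exceptional_point_def Let_def
    by (intro conjI Liminf_bounded Limsup_bounded Liminf_le_Limsup) auto
qed

text \<open>The failure at the single scale \<open>w\<close> of the two-sided bound in
  \<open>K_stmt\<close>, multiplied out by the length of the window.\<close>

definition extreme :: "real \<Rightarrow> real set \<Rightarrow> real \<Rightarrow> real \<Rightarrow> bool" where
  "extreme \<theta> S p w \<longleftrightarrow>
     mes S (p - w) (p + w) < \<theta> * (2 * w) \<or> (1 - \<theta>) * (2 * w) < mes S (p - w) (p + w)"

text \<open>A lower limit of at least \<open>\<delta>\<close> keeps the densities above any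
  \<open>\<theta> < \<delta>\<close> at all small scales, and dually for the upper limit. The strict
  gap matters: the densities may approach \<open>\<delta>\<close> from below.\<close>

lemma not_exceptional_point:
  assumes "\<theta> < \<delta>"
    and "\<And>e. 0 < e \<Longrightarrow> \<exists>w. 0 < w \<and> w \<le> e \<and> extreme \<theta> S p w"
  shows "\<not> exceptional_point \<delta> S p"
proof
  assume "exceptional_point \<delta> S p"
  then have *: "ereal \<delta> \<le> Liminf (at_right 0) (\<lambda>w. ereal (density_in S (nbhd w p)))"
    "Limsup (at_right 0) (\<lambda>w. ereal (density_in S (nbhd w p))) \<le> ereal (1 - \<delta>)"
    by (auto simp: exceptional_point_def Let_def)
  have "\<forall>\<^sub>F w in at_right 0. ereal \<theta> < ereal (density_in S (nbhd w p))"
    by (rule less_LiminfD, rule less_le_trans[OF _ *(1)]) (use assms in simp)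
  moreover have "\<forall>\<^sub>F w in at_right 0. ereal (density_in S (nbhd w p)) < ereal (1 - \<theta>)"
    by (rule Limsup_lessD, rule le_less_trans[OF *(2)]) (use assms in simp)
  ultimately have "\<forall>\<^sub>F w in at_right 0. ereal \<theta> < ereal (density_in S (nbhd w p)) \<and>
      ereal (density_in S (nbhd w p)) < ereal (1 - \<theta>)"
    by (rule eventually_conj)
  then obtain b where "0 < b" and b: "\<And>w. 0 < w \<Longrightarrow> w < b \<Longrightarrow>
      \<theta> < density_in S (nbhd w p) \<and> density_in S (nbhd w p) < 1 - \<theta>"
    unfolding eventually_at_right_field by auto
  obtain w where "0 < w" "w \<le> b / 2" "extreme \<theta> S p w"
    using assms(2)[of "b / 2"] \<open>0 < b\<close> by auto
  with b[of w] \<open>0 < b\<close> show False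
    by (auto simp: extreme_def density_in_nbhd field_simps)
qed

text \<open>The gap between \<open>\<theta>\<close> and \<open>\<theta>'\<close> pays for a change
  of the window. It is used to move the centre with the set fixed, and to change the set with the
  centre fixed.\<close>

lemma extreme_perturb:
  assumes "extreme \<theta> S p w"
    and "\<bar>mes S (p - w) (p + w) - mes T (q - w) (q + w)\<bar> \<le> (\<theta>' - \<theta>) * (2 * w)"
  shows "extreme \<theta>' T q w"
  using assms unfolding extreme_def by (auto simp: algebra_simps)

section \<open>Dense and sparse windows\<close>

text \<open>Lebesgue differentiation of the indicator of \<open>S\<close>, over cubes anchored at
  their lower corner; hence the windows to the right of \<open>x\<close>. Passing to open windows
  discards two points.\<close>

lemma Lebesgue_density_right:
  assumes S: "S \<in> sets lebesgue"
  obtains N where "negligible N"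
    "\<And>x e. x \<notin> N \<Longrightarrow> 0 < e \<Longrightarrow>
      \<exists>d>0. \<forall>h. 0 < h \<and> h < d \<longrightarrow> \<bar>mes S x (x + h) / h - indicator S x\<bar> < e"
proof -
  have Sm: "S \<inter> {u..v} \<in> lmeasurable" for u v
    using fmeasurable_Int_fmeasurable[OF lmeasurable_interval(1) S] by (simp add: Int_commute)
  have int: "indicat_real S integrable_on cbox u v" for u v
    using Sm[of u v] by (simp add: integrable_on_indicator)
  obtain N where N: "negligible N" "\<And>x e. x \<notin> N \<Longrightarrow> 0 < e \<Longrightarrow>
      \<exists>d>0. \<forall>h. 0 < h \<and> h < d \<longrightarrow>
        norm (integral (cbox x (x + h *\<^sub>R One)) (indicat_real S) /\<^sub>R h ^ DIM(real) - indicat_real S x) < e"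
    using integrable_ccontinuous_explicit[OF int] by blast
  have eq: "integral (cbox x (x + h *\<^sub>R One)) (indicat_real S) /\<^sub>R h ^ DIM(real) = mes S x (x + h) / h"
    if "0 < h" for x h :: real
  proof -
    have "integral {x..x + h} (indicat_real S) = measure lebesgue (S \<inter> {x..x + h})"
      by (rule integral_indicator[OF Sm])
    also have "\<dots> = mes S x (x + h)"
    proof -
      let ?D = "{x..x} \<union> {x + h..x + h}"
      have "\<bar>measure lebesgue (S \<inter> {x..x + h}) - mes S x (x + h)\<bar> \<le> measure lebesgue ?D"
        by (intro measure_diff_le Sm lmeasurable_Int_interval[OF S] fmeasurable.Un
            lmeasurable_interval) auto
      also have "\<dots> \<le> measure lebesgue {x..x} + measure lebesgue {x + h..x + h}"
        by (intro measure_Un_le) auto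
      finally show ?thesis by simp
    qed
    finally show ?thesis by (simp add: divide_inverse mult.commute)
  qed
  show ?thesis
  proof (rule that[OF N(1)])
    fix x e :: real assume "x \<notin> N" "0 < e"
    from N(2)[OF this] show "\<exists>d>0. \<forall>h. 0 < h \<and> h < d \<longrightarrow> \<bar>mes S x (x + h) / h - indicator S x\<bar> < e"
      unfolding real_norm_def using eq by metis
  qed
qed

lemma nontrivial_dense_sparse_intervals:
  assumes S: "nontrivial S" and "0 < \<theta>"
  obtains x y h where "0 < h" "(1 - \<theta>) * h < mes S x (x + h)" "mes S y (y + h) < \<theta> * h"
proof -
  have Sl: "S \<in> sets lebesgue" using S by (simp add: nontrivial_def)
  obtain N where N: "negligible N" "\<And>x e. x \<notin> N \<Longrightarrow> 0 < e \<Longrightarrow>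
      \<exists>d>0. \<forall>h. 0 < h \<and> h < d \<longrightarrow> \<bar>mes S x (x + h) / h - indicator S x\<bar> < e"
    using Lebesgue_density_right[OF Sl] by blast
  have neg: "emeasure lebesgue A = 0" if "A \<subseteq> N" for A
    using N(1) that by (meson emeasure_eq_0 negligible_iff_emeasure0 negligible_iff_null_sets
        negligible_subset null_setsD1)
  obtain x where x: "x \<in> S" "x \<notin> N" using neg[of S] S unfolding nontrivial_def by blast
  obtain y where y: "y \<notin> S" "y \<notin> N" using neg[of "UNIV - S"] S unfolding nontrivial_def by blast
  obtain d where d: "0 < d" "\<And>h. 0 < h \<Longrightarrow> h < d \<Longrightarrow> \<bar>mes S x (x + h) / h - 1\<bar> < \<theta>"
    using N(2)[OF x(2) \<open>0 < \<theta>\<close>] x(1) by auto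
  obtain d' where d': "0 < d'" "\<And>h. 0 < h \<Longrightarrow> h < d' \<Longrightarrow> \<bar>mes S y (y + h) / h\<bar> < \<theta>"
    using N(2)[OF y(2) \<open>0 < \<theta>\<close>] y(1) by auto
  \<comment> \<open>Below both thresholds, so that the dense and the sparse window have the same
    length.\<close>
  define h where "h = min d d' / 2"
  have h: "0 < h" "h < d" "h < d'" using d d' by (auto simp: h_def)
  have "1 - \<theta> < mes S x (x + h) / h" "mes S y (y + h) / h < \<theta>"
    using d(2)[of h] d'(2)[of h] h by auto
  with h show ?thesis by (intro that[of h x y]) (auto simp: field_simps)
qed

section \<open>Windows of density one half\<close>

lemma exists_mean_window:
  assumes S: "S \<in> sets lebesgue"
    and "mes S x (x + h) \<le> m" "m \<le> mes S y (y + h)"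
  obtains u where "min x y \<le> u" "u \<le> max x y" "mes S u (u + h) = m"
proof -
  have "connected ((\<lambda>u. mes S u (u + h)) ` {min x y..max x y})"
    by (intro connected_continuous_image continuous_on_mes_window S) auto
  moreover have "mes S x (x + h) \<in> (\<lambda>u. mes S u (u + h)) ` {min x y..max x y}"
    "mes S y (y + h) \<in> (\<lambda>u. mes S u (u + h)) ` {min x y..max x y}" by auto
  ultimately have "m \<in> (\<lambda>u. mes S u (u + h)) ` {min x y..max x y}"
    using assms by (meson connectedD_interval)
  with that show ?thesis by auto
qed

text \<open>The two halves contain \<open>L / 4\<close> on average, so one has at most and the other
  at least that much. Sliding from one to the other passes through the value
  \<open>L / 4\<close>.\<close>

lemma half_window_halving:
  assumes S: "S \<in> sets lebesgue" and "0 < L" "mes S u (u + L) = L / 2"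
  shows "\<exists>v. u \<le> v \<and> v \<le> u + L / 2 \<and> mes S v (v + L / 2) = L / 4"
proof -
  have sum: "mes S u (u + L / 2) + mes S (u + L / 2) (u + L / 2 + L / 2) = L / 2"
    using mes_add[OF S, of u "u + L / 2" "u + L"] assms by (simp add: add.commute add.left_commute)
  show ?thesis
  proof (cases "mes S u (u + L / 2) \<le> L / 4")
    case True
    obtain v where "min u (u + L / 2) \<le> v" "v \<le> max u (u + L / 2)" "mes S v (v + L / 2) = L / 4"
      by (rule exists_mean_window[OF S, of u "L / 2" "L / 4" "u + L / 2"]) (use True sum in auto)
    then show ?thesis using \<open>0 < L\<close> by (intro exI[of _ v]) auto
  next
    case False
    obtain v where "min (u + L / 2) u \<le> v" "v \<le> max (u + L / 2) u" "mes S v (v + L / 2) = L / 4"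
      by (rule exists_mean_window[OF S, of "u + L / 2" "L / 2" "L / 4" u]) (use False sum in auto)
    then show ?thesis using \<open>0 < L\<close> by (intro exI[of _ v]) auto
  qed
qed

text \<open>Halving windows of density \<open>1/2\<close> repeatedly shrinks them to a point around which every small
  interval contains a window of comparable length.\<close>

lemma H_stmt_eighth: "H_stmt (1/8)"
  unfolding H_stmt_def
proof (intro allI impI)
  fix S assume nt: "nontrivial S"
  then have S: "S \<in> sets lebesgue" by (simp add: nontrivial_def)
  obtain x y L where L: "0 < L" "(1 - 1/2) * L < mes S x (x + L)" "mes S y (y + L) < 1/2 * L"
    by (rule nontrivial_dense_sparse_intervals[OF nt, of "1/2"]) auto
  obtain u0 where u0: "mes S u0 (u0 + L) = L / 2"
    using exists_mean_window[OF S, of y L "L/2" x] L by auto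
  have "\<exists>u. \<forall>n. mes S (u n) (u n + L / 2 ^ n) = L / 2 ^ n / 2 \<and>
      (u n \<le> u (Suc n) \<and> u (Suc n) + L / 2 ^ Suc n \<le> u n + L / 2 ^ n)"
  proof (rule dependent_nat_choice)
    show "\<exists>u. mes S u (u + L / 2 ^ 0) = L / 2 ^ 0 / 2" using u0 by auto
    fix u n assume "mes S u (u + L / 2 ^ n) = L / 2 ^ n / 2"
    with half_window_halving[OF S, of "L / 2 ^ n" u] L
    obtain v where v: "u \<le> v" "v \<le> u + L / 2 ^ n / 2" "mes S v (v + L / 2 ^ n / 2) = L / 2 ^ n / 4"
      by auto
    have half: "L / 2 ^ Suc n = L / 2 ^ n / 2" by simp
    show "\<exists>v. mes S v (v + L / 2 ^ Suc n) = L / 2 ^ Suc n / 2 \<and>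
        (u \<le> v \<and> v + L / 2 ^ Suc n \<le> u + L / 2 ^ n)"
      unfolding half by (rule exI[of _ v]) (use v in auto)
  qed
  then obtain u where u: "\<And>n. mes S (u n) (u n + L / 2 ^ n) = L / 2 ^ n / 2"
    "\<And>n. u n \<le> u (Suc n)" "\<And>n. u (Suc n) + L / 2 ^ Suc n \<le> u n + L / 2 ^ n" by blast
  have inc: "incseq u" using u(2) by (rule incseq_SucI)
  have dec: "decseq (\<lambda>n. u n + L / 2 ^ n)" using u(3) by (rule decseq_SucI)
  have cross: "u m \<le> u n + L / 2 ^ n" for m n
  proof -
    have "u m \<le> u (max m n)" using inc by (simp add: incseqD)
    also have "\<dots> \<le> u (max m n) + L / 2 ^ max m n" using L by simp
    also have "\<dots> \<le> u n + L / 2 ^ n" using decseqD[OF dec, of n "max m n"] by simp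
    finally show ?thesis .
  qed
  obtain p where "u \<longlonglongrightarrow> p"
    using incseq_convergent[OF inc, of "u 0 + L"] cross[of _ 0] by (metis div_by_1 power_0)
  then have p: "u n \<le> p" "p \<le> u n + L / 2 ^ n" for n
    using incseq_le[OF inc] cross by (auto intro: LIMSEQ_le_const2)
  show "\<exists>p. exceptional_point (1/8) S p"
  proof (intro exI exceptional_pointI)
    show "0 < L" by fact
    fix w :: real assume w: "0 < w" "w < L"
    \<comment> \<open>\<open>n + 1\<close> is the first index whose window is shorter than
      \<open>w\<close>; it is not \<open>0\<close> because \<open>w < L\<close>.\<close>
    obtain n where n: "L / 2 ^ Suc n < w" "w \<le> L / 2 ^ n"
    proof -
      have "\<exists>n. L / 2 ^ n < w"
        using real_arch_pow_inv[of "w / L" "1/2"] w L by (auto simp: field_simps power_one_over)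
      define n where "n = (LEAST n. L / 2 ^ n < w)"
      have "L / 2 ^ n < w" using \<open>\<exists>n. L / 2 ^ n < w\<close> unfolding n_def by (rule LeastI_ex)
      moreover have "n \<noteq> 0" using \<open>L / 2 ^ n < w\<close> w by (intro notI) simp
      moreover have "w \<le> L / 2 ^ (n - 1)"
        using not_less_Least[of "n - 1" "\<lambda>n. L / 2 ^ n < w"] \<open>n \<noteq> 0\<close> by (simp add: n_def)
      ultimately show ?thesis using that[of "n - 1"] by simp
    qed
    \<comment> \<open>The window contains \<open>p\<close> up to its ends and is shorter than
      \<open>w\<close>, so it lies inside the interval of radius \<open>w\<close> about
      \<open>p\<close>. It brings \<open>l / 2 \<ge> w / 4\<close> of both \<open>S\<close> and its
      complement, which is the fraction \<open>1/8\<close> of \<open>2 * w\<close>.\<close>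
    define v l where "v = u (Suc n)" and "l = L / 2 ^ Suc n"
    have l: "0 < l" "l < w" "w \<le> 2 * l" "mes S v (v + l) = l / 2" "v \<le> p" "p \<le> v + l"
      using n u(1)[of "Suc n"] p[of "Suc n"] L by (auto simp: v_def l_def)
    have 1: "l / 2 \<le> mes S (p - w) (p + w)"
      unfolding l(4)[symmetric] using S l by (intro mes_mono) auto
    have "mes (- S) v (v + l) = l / 2" using mes_compl[OF S, of v "v + l"] l by simp
    moreover have "mes (- S) v (v + l) \<le> mes (- S) (p - w) (p + w)"
      using sets.compl_sets[OF S] l by (intro mes_mono) (auto simp: Compl_eq_Diff_UNIV)
    ultimately have "l / 2 \<le> 2 * w - mes S (p - w) (p + w)"
      using mes_compl[OF S, of "p - w" "p + w"] w by simp
    with 1 l show "1/8 * (2 * w) \<le> mes S (p - w) (p + w) \<and>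
        mes S (p - w) (p + w) \<le> (1 - 1/8) * (2 * w)" by auto
  qed
qed

section \<open>Iterated replacement of end points\<close>

text \<open>Apart from the points of \<open>E\<close>, the set \<open>T\<close> looks on the scale \<open>\<rho>\<close> like the empty set, the full
  line, or a half-line with end point in \<open>E\<close>. Membership of the points of \<open>E\<close> themselves
  is left open.\<close>

definition steplike :: "real set \<Rightarrow> real set \<Rightarrow> real \<Rightarrow> bool" where
  "steplike T E \<rho> \<longleftrightarrow> T \<in> sets borel \<and> finite E \<and> 0 < \<rho> \<and>
     (\<forall>c\<in>E. \<exists>s. (s = 1 \<or> s = - 1) \<and> (\<forall>x. \<bar>x - c\<bar> < \<rho> \<longrightarrow> x \<noteq> c \<longrightarrow> (x \<in> T \<longleftrightarrow> s * (x - c) < 0))) \<and>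
     (\<forall>p r. 0 < r \<longrightarrow> r \<le> \<rho> \<longrightarrow> {p - r<..<p + r} \<inter> E = {} \<longrightarrow>
        {p - r<..<p + r} \<subseteq> T \<or> {p - r<..<p + r} \<inter> T = {})"

lemma steplikeD:
  assumes "steplike T E \<rho>"
  shows "T \<in> sets borel" "T \<in> sets lebesgue" "finite E" "0 < \<rho>"
  using assms by (auto simp: steplike_def)

lemma steplike_uniform:
  assumes "steplike T E \<rho>" "0 < r" "r \<le> \<rho>" "{p - r<..<p + r} \<inter> E = {}"
  shows "{p - r<..<p + r} \<subseteq> T \<or> {p - r<..<p + r} \<inter> T = {}"
  using assms unfolding steplike_def by blast

lemma steplike_sign:
  assumes "steplike T E \<rho>"
  obtains s where "\<And>c. c \<in> E \<Longrightarrow> s c = 1 \<or> s c = - 1"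
    "\<And>c x. c \<in> E \<Longrightarrow> \<bar>x - c\<bar> < \<rho> \<Longrightarrow> x \<noteq> c \<Longrightarrow> x \<in> T \<longleftrightarrow> s c * (x - c) < 0"
proof -
  have "\<forall>c\<in>E. \<exists>s. (s = 1 \<or> s = - 1) \<and>
      (\<forall>x. \<bar>x - c\<bar> < \<rho> \<longrightarrow> x \<noteq> c \<longrightarrow> (x \<in> T \<longleftrightarrow> s * (x - c) < 0))"
    using assms unfolding steplike_def by blast
  then obtain s where "\<forall>c\<in>E. (s c = 1 \<or> s c = - 1) \<and>
      (\<forall>x. \<bar>x - c\<bar> < \<rho> \<longrightarrow> x \<noteq> c \<longrightarrow> (x \<in> T \<longleftrightarrow> s c * (x - c) < 0))"
    by (rule bchoice[THEN exE])
  then show ?thesis by (intro that[of s]) blast+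
qed

text \<open>If \<open>c'\<close> were closer to \<open>c\<close>, then \<open>T\<close> would be
  constant on each side of \<open>c\<close> within reach of \<open>c'\<close>, yet it changes at
  \<open>c'\<close>.\<close>

lemma steplike_separated:
  assumes T: "steplike T E \<rho>" and c: "c \<in> E" "c' \<in> E" "c \<noteq> c'"
  shows "\<rho> \<le> \<bar>c - c'\<bar>"
proof (rule ccontr)
  assume "\<not> ?thesis"
  then have lt: "\<bar>c' - c\<bar> < \<rho>" by auto
  obtain s where s: "\<And>c. c \<in> E \<Longrightarrow> s c = 1 \<or> s c = - 1"
    "\<And>c x. c \<in> E \<Longrightarrow> \<bar>x - c\<bar> < \<rho> \<Longrightarrow> x \<noteq> c \<Longrightarrow> x \<in> T \<longleftrightarrow> s c * (x - c) < 0"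
    by (rule steplike_sign[OF T]) blast
  \<comment> \<open>So small that both points \<open>c' + t\<close> and \<open>c' - t\<close> lie on
    the same side of \<open>c\<close>, within \<open>\<rho>\<close> of \<open>c\<close> and of
    \<open>c'\<close>.\<close>
  define t where "t = min \<bar>c' - c\<bar> (\<rho> - \<bar>c' - c\<bar>) / 2"
  have t: "0 < t" "t < \<bar>c' - c\<bar>" "\<bar>c' - c\<bar> + t < \<rho>" "t < \<rho>"
    using lt c by (auto simp: t_def min_def field_simps)
  have "c' + t \<in> T \<longleftrightarrow> s c * (c' + t - c) < 0" "c' - t \<in> T \<longleftrightarrow> s c * (c' - t - c) < 0"
    "c' + t \<in> T \<longleftrightarrow> s c' * (c' + t - c') < 0" "c' - t \<in> T \<longleftrightarrow> s c' * (c' - t - c') < 0"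
    using t c by (intro s(2); auto)+
  moreover have "c' + t - c > 0 \<longleftrightarrow> c' - t - c > 0" "c' + t - c < 0 \<longleftrightarrow> c' - t - c < 0"
    using t by auto
  ultimately show False using s(1)[OF c(1)] s(1)[OF c(2)] t by auto
qed

text \<open>Near each end point of \<open>T\<close> the half-line is replaced by a copy of \<open>C\<close>, scaled by a small \<open>\<eta>\<close>
  and reflected if necessary.\<close>

lemma steplike_refine:
  assumes C: "steplike C F \<sigma>" and F: "F \<noteq> {}" "F \<subseteq> {0..R}"
    and neg: "\<And>x. x < 0 \<Longrightarrow> x \<in> C" and pos: "\<And>x. R < x \<Longrightarrow> x \<notin> C"
    and ext: "\<And>c. c \<in> F \<Longrightarrow> \<exists>w>0. extreme \<theta> C c w"
    and \<theta>: "\<theta> < \<theta>'" "0 < \<theta>'"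
    and T: "steplike T E \<rho>" and "0 < \<epsilon>"
  obtains T' E' \<rho>' \<kappa> D where "steplike T' E' \<rho>'" "0 < \<kappa>" "D \<in> lmeasurable" "measure lebesgue D \<le> \<epsilon>"
    "T - T' \<subseteq> D" "T' - T \<subseteq> D" "\<And>p. \<exists>r. \<kappa> \<le> r \<and> r \<le> \<epsilon> \<and> extreme \<theta>' T' p r"
proof -
  note [simp] = steplikeD(3)[OF C] steplikeD(3)[OF T]
  have R: "0 \<le> R" using F by fastforce
  have \<rho>: "0 < \<rho>" and \<sigma>: "0 < \<sigma>" using steplikeD(4) C T by auto
  obtain s where s: "\<And>c. c \<in> E \<Longrightarrow> s c = 1 \<or> s c = - 1"
    "\<And>c x. c \<in> E \<Longrightarrow> \<bar>x - c\<bar> < \<rho> \<Longrightarrow> x \<noteq> c \<Longrightarrow> x \<in> T \<longleftrightarrow> s c * (x - c) < 0"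
    by (rule steplike_sign[OF T]) blast
  have sq: "s c * (s c * z) = z" "\<bar>s c * z\<bar> = \<bar>z\<bar>" if "c \<in> E" for c z
    using s(1)[OF that] by (auto simp: abs_mult)
  obtain om where om: "\<And>c. c \<in> F \<Longrightarrow> 0 < om c \<and> extreme \<theta> C c (om c)"
    using ext by metis
  define w W where "w = Min (om ` F)" and "W = Max (om ` F)"
  have w: "0 < w" "w \<le> om c" "om c \<le> W" if "c \<in> F" for c
    using F om by (auto simp: w_def W_def that)
  have w0: "0 < w" and wW: "w \<le> W" using w F by (fastforce intro: order.trans)+
  \<comment> \<open>In the coordinates of \<open>C\<close>, the radius \<open>M\<close> covers all
    end points together with their bad windows; beyond it \<open>C\<close> is a half-line
    again.\<close>
  define M where "M = R + W + \<sigma> + 1"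
  \<comment> \<open>The three bounds make the copies short compared with \<open>\<rho>\<close>, the
    bad scales at most \<open>\<epsilon>\<close>, and the total length of the changed intervals at
    most \<open>\<epsilon>\<close>. The summand \<open>1\<close> covers the case of empty
    \<open>E\<close>.\<close>
  define \<eta> where "\<eta> = Min {\<rho> / (8 * M), \<epsilon> / M, \<epsilon> / (2 * M * (card E + 1))}"
  have M: "R < M" "W < M" "\<sigma> < M" "0 < M" "R + W < M" using R w0 wW \<sigma> by (auto simp: M_def)
  have \<eta>: "0 < \<eta>" "8 * (\<eta> * M) \<le> \<rho>" "\<eta> * M \<le> \<epsilon>" "2 * (\<eta> * M) * card E \<le> \<epsilon>"
  proof -
    show "0 < \<eta>" using M \<rho> \<open>0 < \<epsilon>\<close> by (simp add: \<eta>_def)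
    have "\<eta> \<le> \<rho> / (8 * M)" "\<eta> \<le> \<epsilon> / M" "\<eta> \<le> \<epsilon> / (2 * M * (card E + 1))"
      by (auto simp: \<eta>_def)
    then have "\<eta> * (8 * M) \<le> \<rho>" "\<eta> * M \<le> \<epsilon>" "\<eta> * (2 * M * (card E + 1)) \<le> \<epsilon>"
      using M by (simp_all add: pos_le_divide_eq)
    moreover have "0 \<le> \<eta> * M" using M \<open>0 < \<eta>\<close> by simp
    ultimately show "8 * (\<eta> * M) \<le> \<rho>" "\<eta> * M \<le> \<epsilon>" "2 * (\<eta> * M) * card E \<le> \<epsilon>"
      by (simp_all add: algebra_simps)
  qed
  have \<eta>b: "\<eta> * R \<le> \<eta> * M" "\<eta> * W \<le> \<eta> * M" "\<eta> * \<sigma> \<le> \<eta> * M" "\<eta> * R + \<eta> * W \<le> \<eta> * M"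
    using M \<eta>(1) by (simp_all flip: distrib_left)
  \<comment> \<open>The balls of radius \<open>\<rho> / 2\<close> are disjoint by
    \<open>steplike_separated\<close>, so each point sees at most one copy.\<close>
  define T' where "T' = {x. (\<exists>c\<in>E. \<bar>x - c\<bar> < \<rho> / 2 \<and> s c * (x - c) / \<eta> \<in> C) \<or>
    (x \<in> T \<and> (\<forall>c\<in>E. \<rho> / 2 \<le> \<bar>x - c\<bar>))}"
  define E' where "E' = (\<Union>c\<in>E. (\<lambda>e. c + s c * \<eta> * e) ` F)"
  have near: "x \<in> T' \<longleftrightarrow> s c * (x - c) / \<eta> \<in> C" if "c \<in> E" "\<bar>x - c\<bar> < \<rho> / 2" for c x
  proof -
    have "c' = c" if "c' \<in> E" "\<bar>x - c'\<bar> < \<rho> / 2" for c'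
    proof (rule ccontr)
      assume "c' \<noteq> c"
      with steplike_separated[OF T \<open>c \<in> E\<close> that(1)] have "\<rho> \<le> \<bar>c - c'\<bar>" by simp
      with that \<open>\<bar>x - c\<bar> < \<rho> / 2\<close> show False by linarith
    qed
    moreover have "\<not> (\<forall>c\<in>E. \<rho> / 2 \<le> \<bar>x - c\<bar>)" using that by (auto simp: not_le)
    ultimately show ?thesis using that unfolding T'_def by blast
  qed
  \<comment> \<open>At distance \<open>\<eta> * M\<close> from its centre a copy of \<open>C\<close>
    already equals the half-line that it replaces.\<close>
  have far: "x \<in> T' \<longleftrightarrow> x \<in> T" if "\<And>c. c \<in> E \<Longrightarrow> \<eta> * M \<le> \<bar>x - c\<bar>" for x
  proof (cases "\<exists>c\<in>E. \<bar>x - c\<bar> < \<rho> / 2")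
    case True
    then obtain c where c: "c \<in> E" "\<bar>x - c\<bar> < \<rho> / 2" by auto
    let ?z = "s c * (x - c) / \<eta>"
    have "\<bar>?z\<bar> = \<bar>x - c\<bar> / \<eta>" using \<eta>(1) s(1)[OF c(1)] by auto
    moreover have "M \<le> \<bar>x - c\<bar> / \<eta>" using that[OF c(1)] \<eta>(1) by (simp add: field_simps)
    ultimately have "M \<le> \<bar>?z\<bar>" by simp
    then have "?z \<in> C \<longleftrightarrow> ?z < 0"
      using neg[of ?z] pos[of ?z] M by (cases "?z < 0") auto
    also have "\<dots> \<longleftrightarrow> s c * (x - c) < 0" using \<eta>(1) by (simp add: divide_less_0_iff)
    also have "\<dots> \<longleftrightarrow> x \<in> T"
    proof -
      have "0 < \<eta> * M" using \<eta>(1) M by simp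
      then have "x \<noteq> c" using that[OF c(1)] by auto
      moreover have "\<bar>x - c\<bar> < \<rho>" using c \<rho> by linarith
      ultimately show ?thesis using s(2)[OF c(1), of x] by simp
    qed
    finally show ?thesis using near[OF c] by simp
  next
    case False
    then have "\<rho> / 2 \<le> \<bar>x - c\<bar>" if "c \<in> E" for c using that by (auto simp: not_less)
    with False show ?thesis unfolding T'_def by blast
  qed
  have T'borel: "T' \<in> sets borel"
  proof -
    note [measurable] = steplikeD(1)[OF C] steplikeD(1)[OF T]
    have "T' = (\<Union>c\<in>E. {x \<in> space borel. \<bar>x - c\<bar> < \<rho> / 2 \<and> s c * (x - c) / \<eta> \<in> C}) \<union>
        (T - (\<Union>c\<in>E. {x \<in> space borel. \<bar>x - c\<bar> < \<rho> / 2}))"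
      unfolding T'_def by (auto simp: not_less)
    also have "\<dots> \<in> sets borel" by (intro sets.Un sets.Diff sets.finite_UN) measurable
    finally show ?thesis .
  qed
  have E'fin: "finite E'" by (simp add: E'_def)
  \<comment> \<open>Passes from the coordinate centred at the old end point \<open>c\<close> to the
    one centred at the new end point coming from \<open>e\<close>.\<close>
  have coord: "\<bar>x - c\<bar> < \<rho> / 2" "s c * (x - c) / \<eta> = s c * (x - (c + s c * \<eta> * e)) / \<eta> + e"
    if "c \<in> E" "e \<in> F" "\<bar>x - (c + s c * \<eta> * e)\<bar> < \<eta> * M" for c e x
  proof -
    have "0 \<le> e" "e \<le> R" using F that by auto
    then have "\<bar>s c * \<eta> * e\<bar> \<le> \<eta> * R" using \<eta>(1) s(1)[OF that(1)] by (auto simp: abs_mult)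
    then show "\<bar>x - c\<bar> < \<rho> / 2" using that(3) \<eta> \<eta>b M \<rho> by linarith
    have "s c * (x - (c + s c * \<eta> * e)) = s c * (x - c) - \<eta> * e"
      using sq(1)[OF that(1), of "\<eta> * e"] by (simp add: algebra_simps)
    then show "s c * (x - c) / \<eta> = s c * (x - (c + s c * \<eta> * e)) / \<eta> + e"
      using \<eta>(1) by (simp add: diff_divide_distrib)
  qed
  have step': "steplike T' E' (\<eta> * \<sigma>)"
    unfolding steplike_def
  proof (intro conjI ballI allI impI T'borel E'fin)
    show "0 < \<eta> * \<sigma>" using \<eta> \<sigma> by simp
  next
    fix c' assume "c' \<in> E'"
    then obtain c e where c: "c \<in> E" "e \<in> F" "c' = c + s c * \<eta> * e" by (auto simp: E'_def)
    obtain t where t: "\<And>e. e \<in> F \<Longrightarrow> t e = 1 \<or> t e = - 1"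
      "\<And>e x. e \<in> F \<Longrightarrow> \<bar>x - e\<bar> < \<sigma> \<Longrightarrow> x \<noteq> e \<Longrightarrow> x \<in> C \<longleftrightarrow> t e * (x - e) < 0"
      by (rule steplike_sign[OF C]) blast
    show "\<exists>u. (u = 1 \<or> u = - 1) \<and>
        (\<forall>x. \<bar>x - c'\<bar> < \<eta> * \<sigma> \<longrightarrow> x \<noteq> c' \<longrightarrow> (x \<in> T') = (u * (x - c') < 0))"
    proof (intro exI[of _ "t e * s c"] conjI allI impI)
      show "t e * s c = 1 \<or> t e * s c = - 1" using s(1)[OF c(1)] t(1)[OF c(2)] by auto
      fix x assume x: "\<bar>x - c'\<bar> < \<eta> * \<sigma>" "x \<noteq> c'"
      then have *: "\<bar>x - c\<bar> < \<rho> / 2" "s c * (x - c) / \<eta> = s c * (x - c') / \<eta> + e"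
        using coord[OF c(1,2), of x] \<eta>b c(3) by auto
      let ?z = "s c * (x - c') / \<eta>"
      have "\<bar>?z\<bar> = \<bar>x - c'\<bar> / \<eta>" using \<eta>(1) s(1)[OF c(1)] by auto
      also have "\<dots> < \<sigma>" using x \<eta>(1) by (simp add: field_simps)
      finally have "?z + e \<in> C \<longleftrightarrow> t e * ?z < 0"
        using t(2)[OF c(2), of "?z + e"] x \<eta>(1) s(1)[OF c(1)] by auto
      also have "\<dots> \<longleftrightarrow> t e * s c * (x - c') < 0"
        using \<eta>(1) by (simp add: divide_less_0_iff mult.assoc)
      finally show "(x \<in> T') = (t e * s c * (x - c') < 0)" using near[OF c(1) *(1)] *(2) by simp
    qed
  next
    fix p r assume r: "0 < r" "r \<le> \<eta> * \<sigma>" "{p - r<..<p + r} \<inter> E' = {}"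
    \<comment> \<open>Here \<open>r \<le> \<rho> / 8\<close>. If \<open>p\<close> is within
      \<open>\<rho> / 4\<close> of some \<open>c\<close>, the interval stays in the ball of radius
      \<open>\<rho> / 2\<close> and is pulled back to \<open>C\<close>. Otherwise it keeps distance
      at least \<open>\<rho> / 8 \<ge> \<eta> * M\<close> from \<open>E\<close>, where
      \<open>T'\<close> equals \<open>T\<close>.\<close>
    show "{p - r<..<p + r} \<subseteq> T' \<or> {p - r<..<p + r} \<inter> T' = {}"
    proof (cases "\<exists>c\<in>E. \<bar>p - c\<bar> < \<rho> / 4")
      case True
      then obtain c where c: "c \<in> E" "\<bar>p - c\<bar> < \<rho> / 4" by auto
      let ?z = "\<lambda>x. s c * (x - c) / \<eta>"
      have z: "\<bar>?z x - ?z p\<bar> < r / \<eta>" if "x \<in> {p - r<..<p + r}" for x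
      proof -
        have "?z x - ?z p = s c * (x - p) / \<eta>" by (simp add: algebra_simps diff_divide_distrib)
        then have "\<bar>?z x - ?z p\<bar> = \<bar>x - p\<bar> / \<eta>" using \<eta>(1) s(1)[OF c(1)] by auto
        then show ?thesis using that \<eta>(1) by (auto intro!: divide_strict_right_mono)
      qed
      have "{?z p - r / \<eta><..<?z p + r / \<eta>} \<inter> F = {}"
      proof (rule ccontr)
        assume "\<not> ?thesis"
        then obtain e where "e \<in> F" "?z p - r / \<eta> < e" "e < ?z p + r / \<eta>" by auto
        then have e: "e \<in> F" "\<bar>e - ?z p\<bar> < r / \<eta>" by auto
        let ?x = "c + s c * \<eta> * e"
        have "?x - p = s c * \<eta> * (e - ?z p)"
          using \<eta>(1) s(1)[OF c(1)] by (auto simp: field_simps)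
        then have "\<bar>?x - p\<bar> = \<eta> * \<bar>e - ?z p\<bar>" using \<eta>(1) s(1)[OF c(1)] by (auto simp: abs_mult)
        also have "\<dots> < r" using e(2) \<eta>(1) by (simp add: field_simps)
        finally have "?x \<in> {p - r<..<p + r}" by (auto simp: abs_less_iff)
        moreover have "?x \<in> E'" using c e by (auto simp: E'_def)
        ultimately show False using r by auto
      qed
      then have "{?z p - r / \<eta><..<?z p + r / \<eta>} \<subseteq> C \<or> {?z p - r / \<eta><..<?z p + r / \<eta>} \<inter> C = {}"
        using r \<eta>(1) by (intro steplike_uniform[OF C]) (auto simp: field_simps)
      moreover have "x \<in> T' \<longleftrightarrow> ?z x \<in> C" "?z x \<in> {?z p - r / \<eta><..<?z p + r / \<eta>}"
        if "x \<in> {p - r<..<p + r}" for x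
      proof -
        have "\<bar>x - p\<bar> < r" using that by auto
        then have "\<bar>x - c\<bar> < \<rho> / 2" using c r \<eta> \<eta>b by linarith
        then show "x \<in> T' \<longleftrightarrow> ?z x \<in> C" by (rule near[OF c(1)])
        show "?z x \<in> {?z p - r / \<eta><..<?z p + r / \<eta>}" using z[OF that] by auto
      qed
      ultimately show ?thesis by blast
    next
      case False
      have away: "\<eta> * M \<le> \<bar>x - c\<bar>" if "x \<in> {p - r<..<p + r}" "c \<in> E" for x c
      proof -
        have "\<rho> / 4 \<le> \<bar>p - c\<bar>" using False that by auto
        moreover have "\<bar>x - p\<bar> < r" using that by auto
        ultimately show ?thesis using r \<eta> \<eta>b by linarith
      qed
      have same: "x \<in> T' \<longleftrightarrow> x \<in> T" "x \<notin> E" if "x \<in> {p - r<..<p + r}" for x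
      proof -
        show "x \<in> T' \<longleftrightarrow> x \<in> T" using away[OF that] by (rule far)
        have "0 < \<eta> * M" using \<eta>(1) M by simp
        then show "x \<notin> E" using away[OF that, of x] by auto
      qed
      have "{p - r<..<p + r} \<subseteq> T \<or> {p - r<..<p + r} \<inter> T = {}"
      proof (rule steplike_uniform[OF T r(1)])
        have "0 < \<eta> * M" using \<eta>(1) M by simp
        then show "r \<le> \<rho>" using r(2) \<eta>(2) \<eta>b(3) by linarith
      qed (use same in blast)
      with same show ?thesis by blast
    qed
  qed
  \<comment> \<open>The radius \<open>\<eta> * k\<close> separates the two cases below. The bound by
    \<open>\<sigma>\<close> gives density \<open>0\<close> or \<open>1\<close> when no end point is
    that near; the third bound makes moving the centre to a near end point affordable at every bad
    scale; the bound by \<open>w\<close> makes \<open>\<eta> * k\<close> a lower bound for all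
    scales used.\<close>
  define k where "k = Min {\<sigma>, w, (\<theta>' - \<theta>) * w}"
  have k: "0 < k" "k \<le> \<sigma>" "k \<le> w" "k \<le> (\<theta>' - \<theta>) * w" using \<sigma> w0 \<theta> by (auto simp: k_def)
  have good: "\<exists>r. \<eta> * k \<le> r \<and> r \<le> \<epsilon> \<and> extreme \<theta>' T' p r" for p
  proof (cases "{p - \<eta> * k<..<p + \<eta> * k} \<inter> E' = {}")
    case True
    have r: "0 < \<eta> * k" "\<eta> * k \<le> \<eta> * \<sigma>" using \<eta> k by auto
    then have "{p - \<eta> * k<..<p + \<eta> * k} \<subseteq> T' \<or> {p - \<eta> * k<..<p + \<eta> * k} \<inter> T' = {}"
      using True by (intro steplike_uniform[OF step'])
    then have "mes T' (p - \<eta> * k) (p + \<eta> * k) = 2 * (\<eta> * k) \<or> mes T' (p - \<eta> * k) (p + \<eta> * k) = 0"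
      using mes_full[of "p - \<eta> * k" "p + \<eta> * k" T'] mes_empty[of "p - \<eta> * k" "p + \<eta> * k" T'] r
      by auto
    moreover have "0 < \<theta>' * (2 * (\<eta> * k))" using r \<theta> by simp
    ultimately have "extreme \<theta>' T' p (\<eta> * k)" unfolding extreme_def by (auto simp: algebra_simps)
    moreover have "\<eta> * k \<le> \<epsilon>" using r \<eta>(3) \<eta>b(3) by linarith
    ultimately show ?thesis by blast
  next
    case False
    then obtain c' where "c' \<in> E'" "p - \<eta> * k < c'" "c' < p + \<eta> * k" by auto
    then have c': "c' \<in> E'" "\<bar>c' - p\<bar> < \<eta> * k" by auto
    from c'(1) obtain c e where c: "c \<in> E" "e \<in> F" "c' = c + s c * \<eta> * e" by (auto simp: E'_def)
    note om_e = om[OF c(2)] w[OF c(2)]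
    have scale: "mes T' (c' - \<eta> * om e) (c' + \<eta> * om e) = \<eta> * mes C (e - om e) (e + om e)"
    proof (rule mes_affine[OF steplikeD(2)[OF C] \<eta>(1) s(1)[OF c(1)]])
      fix x assume "\<bar>x - c'\<bar> < \<eta> * om e"
      moreover have "\<eta> * om e \<le> \<eta> * M" using om_e M \<eta>(1) by simp
      ultimately show "x \<in> T' \<longleftrightarrow> s c * (x - c') / \<eta> + e \<in> C"
        using coord[OF c(1,2), of x] near[OF c(1), of x] c(3) by auto
    qed
    have "\<bar>mes T' (c' - \<eta> * om e) (c' + \<eta> * om e) - mes T' (p - \<eta> * om e) (p + \<eta> * om e)\<bar>
        \<le> 2 * \<bar>c' - p\<bar>"
      using mes_lipschitz[OF steplikeD(2)[OF step'],
          of "c' - \<eta> * om e" "c' + \<eta> * om e" "p - \<eta> * om e" "p + \<eta> * om e"] by simp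
    also have "\<dots> \<le> 2 * (\<eta> * ((\<theta>' - \<theta>) * om e))"
    proof -
      have "k \<le> (\<theta>' - \<theta>) * om e"
        using k(4) om_e \<theta> by (meson diff_ge_0_iff_ge less_imp_le mult_left_mono order.trans)
      then have "\<eta> * k \<le> \<eta> * ((\<theta>' - \<theta>) * om e)" using \<eta>(1) by simp
      then show ?thesis using c'(2) by simp
    qed
    finally have pert: "\<bar>mes T' (c' - \<eta> * om e) (c' + \<eta> * om e) - mes T' (p - \<eta> * om e) (p + \<eta> * om e)\<bar>
        \<le> (\<theta>' - \<theta>) * (2 * (\<eta> * om e))" by (simp add: algebra_simps)
    have "extreme \<theta> T' c' (\<eta> * om e)"
    proof -
      have "a < \<eta> * b \<longleftrightarrow> a / \<eta> < b" "\<eta> * b < a \<longleftrightarrow> b < a / \<eta>" for a b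
        using \<eta>(1) by (auto simp: field_simps)
      then show ?thesis
        using om_e(1) \<eta>(1) unfolding extreme_def scale by (auto simp: mult.left_commute[of _ \<eta>])
    qed
    then have "extreme \<theta>' T' p (\<eta> * om e)" using pert by (rule extreme_perturb)
    moreover have "\<eta> * k \<le> \<eta> * om e" "\<eta> * om e \<le> \<eta> * W" using k om_e \<eta>(1) by simp_all
    moreover from this(2) have "\<eta> * om e \<le> \<epsilon>" using \<eta>(3) \<eta>b(2) by linarith
    ultimately show ?thesis by blast
  qed
  define D where "D = (\<Union>c\<in>E. {c - \<eta> * M..c + \<eta> * M})"
  have "D \<in> lmeasurable" unfolding D_def by (intro fmeasurable.finite_UN) auto
  moreover have "measure lebesgue D \<le> \<epsilon>"
  proof -
    have "measure lebesgue D \<le> (\<Sum>c\<in>E. measure lebesgue {c - \<eta> * M..c + \<eta> * M})"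
      unfolding D_def by (rule measure_UNION_le) auto
    also have "\<dots> \<le> \<epsilon>" using \<eta> M by (simp add: mult.commute)
    finally show ?thesis .
  qed
  moreover have "x \<in> D" if "x \<in> T \<longleftrightarrow> x \<notin> T'" for x
  proof (rule ccontr)
    assume "x \<notin> D"
    then have "\<eta> * M \<le> \<bar>x - c\<bar>" if "c \<in> E" for c using that unfolding D_def by fastforce
    with far[of x] that show False by blast
  qed
  then have "T - T' \<subseteq> D" "T' - T \<subseteq> D" by auto
  ultimately show ?thesis using step' good k(1) \<eta>(1) by (intro that[of T' E' "\<eta> * \<sigma>" "\<eta> * k" D]) auto
qed

section \<open>The limit of the refinements\<close>

text \<open>The number \<open>\<epsilon> n\<close> bounds the change from stage \<open>n\<close> to
  the next and the scales found there, and \<open>\<kappa> n\<close> bounds these scales from below.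
  All later changes together have measure at most
  \<open>2 * \<epsilon> (Suc n) \<le> 2 * \<tau> * \<kappa> n\<close>, too little to spoil a scale
  of at least \<open>\<kappa> n\<close>.\<close>

lemma extreme_limit_set:
  assumes C: "steplike C F \<sigma>" and F: "F \<noteq> {}" "F \<subseteq> {0..R}"
    and neg: "\<And>x. x < 0 \<Longrightarrow> x \<in> C" and pos: "\<And>x. R < x \<Longrightarrow> x \<notin> C"
    and ext: "\<And>c. c \<in> F \<Longrightarrow> \<exists>w>0. extreme \<theta> C c w"
    and \<theta>: "0 \<le> \<theta>" "\<theta> < \<theta>'"
  obtains S where "nontrivial S" "\<And>p e. 0 < e \<Longrightarrow> \<exists>w. 0 < w \<and> w \<le> e \<and> extreme \<theta>' S p w"
proof -
  \<comment> \<open>Half of the gap is spent inside each refinement, the other half on the passage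
    to the limit.\<close>
  define \<mu> \<tau> where "\<mu> = (\<theta> + \<theta>') / 2" and "\<tau> = \<theta>' - \<mu>"
  have \<mu>: "\<theta> < \<mu>" "0 < \<mu>" and \<tau>: "0 < \<tau>" using \<theta> by (auto simp: \<mu>_def \<tau>_def field_simps)
  define P where "P = (\<lambda>(n::nat) (T, E, \<rho>, \<epsilon> :: real). steplike T E \<rho> \<and> 0 < \<epsilon> \<and>
    (n = 0 \<longrightarrow> T = {..<0} \<and> \<epsilon> = 1 / 8))"
  define Q where "Q = (\<lambda>(T, E :: real set, \<rho> :: real, \<epsilon>) (T', E' :: real set, \<rho>' :: real, \<epsilon>'). \<exists>\<kappa> D. D \<in> lmeasurable \<and>
    measure lebesgue D \<le> \<epsilon> \<and> T - T' \<subseteq> D \<and> T' - T \<subseteq> D \<and> \<epsilon>' \<le> \<epsilon> / 2 \<and> 0 < \<kappa> \<and> \<epsilon>' \<le> \<tau> * \<kappa> \<and>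
    (\<forall>p. \<exists>r. \<kappa> \<le> r \<and> r \<le> \<epsilon> \<and> extreme \<mu> T' p r))"
  have "\<exists>X. \<forall>n. P n (X n) \<and> Q (X n) (X (Suc n))"
  proof (rule dependent_nat_choice)
    have "steplike {..<0} {0} 1"
      unfolding steplike_def
    proof (intro conjI ballI allI impI)
      fix c :: real assume "c \<in> {0}"
      then show "\<exists>s. (s = 1 \<or> s = - 1) \<and>
          (\<forall>x. \<bar>x - c\<bar> < 1 \<longrightarrow> x \<noteq> c \<longrightarrow> (x \<in> {..<0}) = (s * (x - c) < 0))"
        by (intro exI[of _ 1]) auto
    next
      fix p r :: real assume "0 < r" "{p - r<..<p + r} \<inter> {0} = {}"
      then have "p + r \<le> 0 \<or> 0 \<le> p - r" by auto
      then show "{p - r<..<p + r} \<subseteq> {..<0} \<or> {p - r<..<p + r} \<inter> {..<0} = {}" by auto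
    qed auto
    then show "\<exists>X. P 0 X" by (intro exI[of _ "({..<0}, {0}, 1, 1 / 8)"]) (simp add: P_def)
  next
    fix X n assume "P n X"
    then obtain T E \<rho> \<epsilon> where X: "X = (T, E, \<rho>, \<epsilon>)" "steplike T E \<rho>" "0 < \<epsilon>"
      by (cases X) (auto simp: P_def)
    obtain T' E' \<rho>' \<kappa> D where *: "steplike T' E' \<rho>'" "0 < \<kappa>" "D \<in> lmeasurable"
      "measure lebesgue D \<le> \<epsilon>" "T - T' \<subseteq> D" "T' - T \<subseteq> D"
      "\<And>p. \<exists>r. \<kappa> \<le> r \<and> r \<le> \<epsilon> \<and> extreme \<mu> T' p r"
      by (rule steplike_refine[OF C F neg pos ext \<mu> X(2,3)])
        (assumption, assumption, assumption, rule that)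
    show "\<exists>Y. P (Suc n) Y \<and> Q X Y"
    proof (intro exI[of _ "(T', E', \<rho>', min (\<epsilon> / 2) (\<tau> * \<kappa>))"] conjI)
      show "P (Suc n) (T', E', \<rho>', min (\<epsilon> / 2) (\<tau> * \<kappa>))"
        using * X \<tau> by (simp add: P_def)
      show "Q X (T', E', \<rho>', min (\<epsilon> / 2) (\<tau> * \<kappa>))"
        unfolding Q_def X(1) prod.case
        by (rule exI[of _ \<kappa>], rule exI[of _ D]) (use * in auto)
    qed
  qed
  then obtain X where X: "\<And>n. P n (X n)" "\<And>n. Q (X n) (X (Suc n))" by blast
  define T \<epsilon> where "T n = fst (X n)" and "\<epsilon> n = snd (snd (snd (X n)))" for n
  have T: "T n \<in> sets borel" "0 < \<epsilon> n" for n
    using X(1)[of n] by (auto simp: P_def T_def \<epsilon>_def steplike_def split: prod.splits)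
  have T0: "T 0 = {..<0}" "\<epsilon> 0 = 1 / 8"
    using X(1)[of 0] by (auto simp: P_def T_def \<epsilon>_def split: prod.splits)
  have "\<exists>\<kappa> D. D \<in> lmeasurable \<and> measure lebesgue D \<le> \<epsilon> n \<and> T n - T (Suc n) \<subseteq> D \<and> T (Suc n) - T n \<subseteq> D \<and>
    \<epsilon> (Suc n) \<le> \<epsilon> n / 2 \<and> 0 < \<kappa> \<and> \<epsilon> (Suc n) \<le> \<tau> * \<kappa> \<and>
    (\<forall>p. \<exists>r. \<kappa> \<le> r \<and> r \<le> \<epsilon> n \<and> extreme \<mu> (T (Suc n)) p r)" for n
    using X(2)[of n] unfolding Q_def T_def \<epsilon>_def by (simp add: case_prod_beta)
  then obtain \<kappa> D where D: "\<And>n. D n \<in> lmeasurable" "\<And>n. measure lebesgue (D n) \<le> \<epsilon> n"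
    "\<And>n. T n - T (Suc n) \<subseteq> D n" "\<And>n. T (Suc n) - T n \<subseteq> D n"
    and \<epsilon>: "\<And>n. \<epsilon> (Suc n) \<le> \<epsilon> n / 2" "\<And>n. \<epsilon> (Suc n) \<le> \<tau> * \<kappa> n"
    and \<kappa>: "\<And>n. 0 < \<kappa> n" "\<And>n p. \<exists>r. \<kappa> n \<le> r \<and> r \<le> \<epsilon> n \<and> extreme \<mu> (T (Suc n)) p r"
    by metis
  \<comment> \<open>The lower limit of the stages. Outside \<open>U n\<close> membership no longer
    changes from stage \<open>n\<close> on, so \<open>S\<close> and \<open>T n\<close> can differ
    only in \<open>U n\<close>.\<close>
  define S where "S = (\<Union>n. \<Inter>k. T (n + k))"
  define U where "U n = (\<Union>k. D (n + k))" for n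
  have "S \<in> sets borel" using T(1) unfolding S_def by (intro sets.countable_UN sets.countable_INT) auto
  then have S: "S \<in> sets lebesgue" by simp
  have U: "U n \<in> lmeasurable" "measure lebesgue (U n) \<le> 2 * \<epsilon> n" for n
  proof -
    have "measure lebesgue (\<Union>k\<le>j. D (n + k)) \<le> 2 * \<epsilon> n" for j
    proof -
      have "measure lebesgue (\<Union>k\<le>j. D (n + k)) \<le> (\<Sum>k\<le>j. measure lebesgue (D (n + k)))"
        by (rule measure_UNION_le) (use D in auto)
      also have "\<dots> \<le> (\<Sum>k\<le>j. \<epsilon> (n + k))" by (intro sum_mono D)
      \<comment> \<open>Subtracting the last term strengthens the claim so that the halving of
        \<open>\<epsilon>\<close> carries the induction.\<close>
      also have "\<dots> \<le> 2 * \<epsilon> n - \<epsilon> (n + j)"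
      proof (induction j)
        case (Suc j)
        then show ?case using \<epsilon>(1)[of "n + j"] by simp
      qed simp
      finally show ?thesis using T(2)[of "n + j"] by simp
    qed
    then show "U n \<in> lmeasurable" "measure lebesgue (U n) \<le> 2 * \<epsilon> n"
      unfolding U_def using D(1)
      by (auto intro!: fmeasurable_countable_Union measure_countable_Union_le)
  qed
  have sub: "x \<in> U n" if "x \<in> S \<longleftrightarrow> x \<notin> T n" for x n
  proof (rule ccontr)
    assume "x \<notin> U n"
    then have "x \<in> T (Suc (n + k)) \<longleftrightarrow> x \<in> T (n + k)" for k
      using D(3,4)[of "n + k"] unfolding U_def by blast
    then have const: "x \<in> T (n + k) \<longleftrightarrow> x \<in> T n" for k by (induction k) auto
    have "x \<in> S \<longleftrightarrow> x \<in> T n"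
    proof
      assume "x \<in> S"
      then obtain m where "\<And>k. x \<in> T (m + k)" by (auto simp: S_def)
      from this[of n] const[of m] show "x \<in> T n" by (simp add: add.commute)
    next
      assume "x \<in> T n"
      then show "x \<in> S" unfolding S_def using const by blast
    qed
    with that show False by simp
  qed
  have approx: "\<bar>mes S u v - mes (T n) u v\<bar> \<le> 2 * \<epsilon> n" for u v n
  proof -
    have "\<bar>mes S u v - mes (T n) u v\<bar> \<le> measure lebesgue (U n)"
      by (intro measure_diff_le lmeasurable_Int_interval S U) (use T sub in auto)
    with U(2)[of n] show ?thesis by simp
  qed
  have "nontrivial S"
  proof -
    have nonnull: "emeasure lebesgue A \<noteq> 0" if "A \<in> sets lebesgue" "3 / 4 \<le> mes A u v" for A u v
    proof
      assume "emeasure lebesgue A = 0"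
      then have "emeasure lebesgue (A \<inter> {u<..<v}) = 0"
        using emeasure_mono[of "A \<inter> {u<..<v}" A lebesgue] that by simp
      then have "mes A u v = 0" by (simp add: measure_def)
      with that show False by simp
    qed
    \<comment> \<open>The choice \<open>\<epsilon> 0 = 1 / 8\<close> bounds the total change of the
      half-line by \<open>1 / 4\<close>, so most of each unit interval next to \<open>0\<close> is
      unaffected.\<close>
    have "mes (T 0) (- 1) 0 = 0 - (- 1)" by (rule mes_full) (auto simp: T0)
    with approx[of "- 1" 0 0] T0(2) have "3 / 4 \<le> mes S (- 1) 0" by linarith
    then have "emeasure lebesgue S \<noteq> 0" by (rule nonnull[OF S])
    moreover have "mes (T 0) 0 1 = 0" by (rule mes_empty) (auto simp: T0)
    with approx[of 0 1 0] T0(2) mes_compl[OF S, of 0 1] have "3 / 4 \<le> mes (- S) 0 1" by linarith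
    then have "3 / 4 \<le> mes (UNIV - S) 0 1" by (simp only: Compl_eq_Diff_UNIV)
    then have "emeasure lebesgue (UNIV - S) \<noteq> 0" by (rule nonnull[rotated]) (use sets.compl_sets[OF S] in simp)
    ultimately show ?thesis using S unfolding nontrivial_def by simp
  qed
  moreover have "\<exists>w. 0 < w \<and> w \<le> e \<and> extreme \<theta>' S p w" if "0 < e" for p e
  proof -
    have pow: "\<epsilon> n \<le> (1/2) ^ n" for n
    proof (induction n)
      case (Suc n)
      then show ?case using \<epsilon>(1)[of n] by simp
    qed (simp add: T0)
    obtain n where "(1/2) ^ n < e" using real_arch_pow_inv[OF \<open>0 < e\<close>, of "1/2"] by auto
    obtain r where r: "\<kappa> n \<le> r" "r \<le> \<epsilon> n" "extreme \<mu> (T (Suc n)) p r" using \<kappa>(2) by blast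
    have "\<epsilon> (Suc n) \<le> \<tau> * r"
      using \<epsilon>(2)[of n] mult_left_mono[OF r(1), of \<tau>] \<tau> by linarith
    then have "2 * \<epsilon> (Suc n) \<le> (\<theta>' - \<mu>) * (2 * r)" by (simp add: \<tau>_def)
    with approx[of "p - r" "p + r" "Suc n"]
    have "\<bar>mes (T (Suc n)) (p - r) (p + r) - mes S (p - r) (p + r)\<bar> \<le> (\<theta>' - \<mu>) * (2 * r)"
      by linarith
    then have "extreme \<theta>' S p r" by (rule extreme_perturb[OF r(3)])
    moreover have "0 < r" "r \<le> e" using \<kappa>(1)[of n] r pow[of n] \<open>(1/2) ^ n < e\<close> by auto
    ultimately show ?thesis by blast
  qed
  ultimately show ?thesis by (rule that)
qed

section \<open>Configurations as steplike sets\<close>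

lemma config_data_less:
  assumes "config_data r a b"
  shows "\<lbrakk>1 \<le> i; i \<le> r\<rbrakk> \<Longrightarrow> 0 < a i" "\<lbrakk>1 \<le> i; i \<le> r\<rbrakk> \<Longrightarrow> a i < b i"
    and "\<lbrakk>1 \<le> i; i < j; j \<le> r\<rbrakk> \<Longrightarrow> b i < a j"
proof -
  have 1: "1 \<le> r \<Longrightarrow> 0 < a 1" "\<And>i. 1 \<le> i \<Longrightarrow> i \<le> r \<Longrightarrow> a i < b i"
    "\<And>i. 1 \<le> i \<Longrightarrow> i < r \<Longrightarrow> b i < a (Suc i)"
    using assms by (auto simp: config_data_def)
  show less: "b i < a j" if "1 \<le> i" "i < j" "j \<le> r" for i j
    using that
  proof (induction j)
    case (Suc j)
    show ?case
    proof (cases "i = j")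
      case True
      with Suc show ?thesis using 1(3) by simp
    next
      case False
      with Suc show ?thesis using 1(2)[of j] 1(3)[of j] by force
    qed
  qed simp
  show "a i < b i" if "1 \<le> i" "i \<le> r" for i using 1(2) that .
  show "0 < a i" if "1 \<le> i" "i \<le> r" for i
  proof (cases "i = 1")
    case True
    then show ?thesis using 1(1) that by simp
  next
    case False
    then show ?thesis using less[of 1 i] 1(1) 1(2)[of 1] that by force
  qed
qed

lemma config_sets_borel [measurable]: "config r a b \<in> sets borel"
  unfolding config_def by auto

text \<open>Between a point of the configuration and a point outside it there is an end point:
  \<open>0\<close>, or an end of the component that contains the first point.\<close>

lemma config_uniform:
  assumes "{u<..<v} \<inter> config_endpoints r a b = {}"
  shows "{u<..<v} \<subseteq> config r a b \<or> {u<..<v} \<inter> config r a b = {}"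
proof (rule ccontr)
  assume "\<not> ?thesis"
  then obtain x y where xy: "x \<in> {u<..<v}" "y \<in> {u<..<v}" "x \<in> config r a b" "y \<notin> config r a b" by blast
  have no: "e \<notin> config_endpoints r a b" if "min x y \<le> e" "e \<le> max x y" for e
  proof -
    have "e \<in> {u<..<v}" using xy(1,2) that by auto
    with assms show ?thesis by blast
  qed
  have ep: "0 \<in> config_endpoints r a b"
    "\<And>i. i \<in> {1..r} \<Longrightarrow> a i \<in> config_endpoints r a b \<and> b i \<in> config_endpoints r a b"
    by (auto simp: config_endpoints_def)
  from xy(3) consider "x < 0" | i where "i \<in> {1..r}" "a i < x" "x < b i"
    by (auto simp: config_def)
  then show False
  proof cases
    case 1
    then show ?thesis using no[of 0] ep(1) xy(4) by (force simp: config_def)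
  next
    case (2 i)
    then have "y \<le> a i \<or> b i \<le> y" using xy(4) by (force simp: config_def)
    then show ?thesis using no[of "a i"] no[of "b i"] ep(2)[OF 2(1)] 2 by auto
  qed
qed

lemma finite_separated:
  fixes F :: "real set"
  assumes "finite F"
  obtains \<sigma> where "0 < \<sigma>" "\<And>c d. c \<in> F \<Longrightarrow> d \<in> F \<Longrightarrow> c \<noteq> d \<Longrightarrow> \<sigma> \<le> \<bar>c - d\<bar>"
proof -
  \<comment> \<open>The extra element keeps the minimum defined when \<open>F\<close> has at most
    one element.\<close>
  let ?A = "insert 1 ((\<lambda>(c, d). \<bar>c - d\<bar>) ` {(c, d) \<in> F \<times> F. c \<noteq> d})"
  have fin: "finite ?A" using assms by (auto intro: finite_subset[of _ "F \<times> F"])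
  show ?thesis
  proof (rule that[of "Min ?A"])
    show "0 < Min ?A" using fin by (subst Min_gr_iff) auto
    show "Min ?A \<le> \<bar>c - d\<bar>" if "c \<in> F" "d \<in> F" "c \<noteq> d" for c d
      using fin that by (intro Min_le) auto
  qed
qed

lemma config_steplike:
  assumes d: "config_data r a b"
  obtains \<sigma> where "steplike (config r a b) (config_endpoints r a b) \<sigma>"
proof -
  let ?C = "config r a b" and ?F = "config_endpoints r a b"
  note less = config_data_less[OF d]
  have fin: "finite ?F" by (simp add: config_endpoints_def)
  obtain \<sigma> where \<sigma>: "0 < \<sigma>" "\<And>c d. c \<in> ?F \<Longrightarrow> d \<in> ?F \<Longrightarrow> c \<noteq> d \<Longrightarrow> \<sigma> \<le> \<bar>c - d\<bar>"
    using finite_separated[OF fin] by blast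
  have ep: "0 \<in> ?F" "\<And>i. i \<in> {1..r} \<Longrightarrow> a i \<in> ?F" "\<And>i. i \<in> {1..r} \<Longrightarrow> b i \<in> ?F"
    by (auto simp: config_endpoints_def)
  have gap: "e \<le> c - \<sigma> \<or> e = c \<or> c + \<sigma> \<le> e" if "c \<in> ?F" "e \<in> ?F" for c e
    using \<sigma>(2)[OF that] by (cases "e = c") (auto simp: abs_if split: if_splits)
  have iffs: "x \<in> ?C \<longleftrightarrow> x < 0 \<or> (\<exists>i\<in>{1..r}. a i < x \<and> x < b i)" for x
    by (auto simp: config_def)
  have "steplike ?C ?F \<sigma>"
    unfolding steplike_def
  proof (intro conjI ballI allI impI fin \<sigma>(1))
    show "?C \<in> sets borel" by measurable
  next
    fix p s assume "{p - s<..<p + s} \<inter> ?F = {}"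
    then show "{p - s<..<p + s} \<subseteq> ?C \<or> {p - s<..<p + s} \<inter> ?C = {}" by (rule config_uniform)
  next
    fix c assume c: "c \<in> ?F"
    then consider "c = 0" | i where "i \<in> {1..r}" "c = a i" | i where "i \<in> {1..r}" "c = b i"
      by (auto simp: config_endpoints_def)
    \<comment> \<open>The configuration lies locally to the left of \<open>0\<close> and of each
      \<open>b i\<close>, where the sign is \<open>1\<close>, and to the right of each
      \<open>a i\<close>, where it is \<open>- 1\<close>. By \<open>gap\<close> no other end point
      comes within \<open>\<sigma>\<close>.\<close>
    then show "\<exists>s. (s = 1 \<or> s = - 1) \<and>
        (\<forall>x. \<bar>x - c\<bar> < \<sigma> \<longrightarrow> x \<noteq> c \<longrightarrow> (x \<in> ?C) = (s * (x - c) < 0))"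
    proof cases
      case 1
      have "x \<in> ?C \<longleftrightarrow> x < 0" if "\<bar>x\<bar> < \<sigma>" for x
      proof -
        have "\<sigma> \<le> a i" if "i \<in> {1..r}" for i
          using gap[OF ep(1) ep(2)[OF that]] less(1)[of i] that \<sigma>(1) by auto
        then show ?thesis using that by (force simp: iffs)
      qed
      then show ?thesis using 1 by (intro exI[of _ 1]) auto
    next
      case (2 i)
      have b: "c + \<sigma> \<le> b i" using gap[OF c ep(3)[OF 2(1)]] less(2)[of i] 2 \<sigma>(1) by auto
      have c0: "\<sigma> \<le> c" using gap[OF c ep(1)] less(1)[of i] 2 \<sigma>(1) by auto
      have "x \<in> ?C \<longleftrightarrow> c < x" if x: "\<bar>x - c\<bar> < \<sigma>" "x \<noteq> c" for x
      proof
        assume "c < x"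
        then show "x \<in> ?C" using 2 b x by (force simp: iffs)
      next
        assume "x \<in> ?C"
        then consider "x < 0" | j where "j \<in> {1..r}" "a j < x" "x < b j" by (auto simp: iffs)
        then show "c < x"
        proof cases
          case 1
          then show ?thesis using x c0 by auto
        next
          case (2 j)
          consider "j < i" | "j = i" | "i < j" by linarith
          then show ?thesis
          proof cases
            case 1
            then have "b j < c" using less(3)[of j i] 2 \<open>i \<in> {1..r}\<close> \<open>c = a i\<close> by auto
            then show ?thesis using gap[OF c ep(3)[OF 2(1)]] 2 x \<sigma>(1) by auto
          next
            case 3
            then show ?thesis
              using less(3)[of i j] less(2)[of i] 2 \<open>i \<in> {1..r}\<close> \<open>c = a i\<close> by auto
          qed (use 2 \<open>c = a i\<close> in auto)
        qed
      qed
      then show ?thesis by (intro exI[of _ "-1"]) auto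
    next
      case (3 i)
      have a: "a i \<le> c - \<sigma>" using gap[OF c ep(2)[OF 3(1)]] less(2)[of i] 3 \<sigma>(1) by auto
      have c0: "\<sigma> \<le> c" using gap[OF c ep(1)] less(1)[of i] less(2)[of i] 3 \<sigma>(1) by auto
      have "x \<in> ?C \<longleftrightarrow> x < c" if x: "\<bar>x - c\<bar> < \<sigma>" "x \<noteq> c" for x
      proof
        assume "x < c"
        then show "x \<in> ?C" using 3 a x by (force simp: iffs)
      next
        assume "x \<in> ?C"
        then consider "x < 0" | j where "j \<in> {1..r}" "a j < x" "x < b j" by (auto simp: iffs)
        then show "x < c"
        proof cases
          case 1
          then show ?thesis using x c0 by auto
        next
          case (2 j)
          consider "j < i" | "j = i" | "i < j" by linarith
          then show ?thesis
          proof cases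
            case 1
            then show ?thesis
              using less(3)[of j i] less(2)[of i] 2 \<open>i \<in> {1..r}\<close> \<open>c = b i\<close> by auto
          next
            case 3
            then have "c < a j" using less(3)[of i j] 2 \<open>i \<in> {1..r}\<close> \<open>c = b i\<close> by auto
            then show ?thesis using gap[OF c ep(2)[OF 2(1)]] 2 x \<sigma>(1) by auto
          qed (use 2 \<open>c = b i\<close> in auto)
        qed
      qed
      then show ?thesis by (intro exI[of _ 1]) auto
    qed
  qed
  then show ?thesis by (rule that)
qed

section \<open>From nontrivial sets to configurations\<close>

lemma H_imp_K:
  assumes H: "H_stmt \<delta>" and "0 < \<delta>'" "\<delta>' < \<delta>"
  shows "K_stmt \<delta>'"
  unfolding K_stmt_def
proof (intro allI impI, rule ccontr)
  fix r a b
  let ?C = "config r a b" and ?F = "config_endpoints r a b"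
  assume d: "config_data r a b" and
    no: "\<not> (\<exists>c\<in>?F. \<forall>\<omega>>0. \<delta>' \<le> density_in ?C (nbhd \<omega> c) \<and> density_in ?C (nbhd \<omega> c) \<le> 1 - \<delta>')"
  have ext: "\<exists>w>0. extreme \<delta>' ?C c w" if c: "c \<in> ?F" for c
  proof -
    obtain w where "0 < w" "density_in ?C (nbhd w c) < \<delta>' \<or> 1 - \<delta>' < density_in ?C (nbhd w c)"
      using no c by (meson not_le)
    then show ?thesis
      by (intro exI[of _ w]) (auto simp: extreme_def density_in_nbhd field_simps)
  qed
  obtain \<sigma> where \<sigma>: "steplike ?C ?F \<sigma>" using config_steplike[OF d] by blast
  have fin: "finite ?F" and ne: "?F \<noteq> {}" by (simp_all add: config_endpoints_def)
  have F: "?F \<subseteq> {0..Max ?F}"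
  proof
    fix c assume "c \<in> ?F"
    moreover from this have "0 \<le> c"
      using config_data_less(1,2)[OF d] by (fastforce simp: config_endpoints_def)
    ultimately show "c \<in> {0..Max ?F}" using fin by auto
  qed
  have pos: "x \<notin> ?C" if "Max ?F < x" for x
  proof -
    have "c < x" if "c \<in> ?F" for c using \<open>Max ?F < x\<close> Max_ge[OF fin that] by simp
    then have "0 < x" "\<And>i. i \<in> {1..r} \<Longrightarrow> b i < x" by (auto simp: config_endpoints_def)
    then show ?thesis by (force simp: config_def)
  qed
  \<comment> \<open>Stopping at the midpoint leaves the strict gap below \<open>\<delta>\<close>
    that \<open>not_exceptional_point\<close> requires.\<close>
  obtain S where S: "nontrivial S"
    "\<And>p e. 0 < e \<Longrightarrow> \<exists>w. 0 < w \<and> w \<le> e \<and> extreme ((\<delta>' + \<delta>) / 2) S p w"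
    by (rule extreme_limit_set[OF \<sigma> ne F _ pos ext, of "(\<delta>' + \<delta>) / 2"])
      (use assms in \<open>auto simp: config_def\<close>)
  obtain p where "exceptional_point \<delta> S p" using H S(1) by (auto simp: H_stmt_def)
  moreover have "\<not> exceptional_point \<delta> S p"
    by (rule not_exceptional_point[OF _ S(2)]) (use assms in auto)
  ultimately show False by simp
qed

section \<open>Approximation by configurations\<close>

text \<open>Each of the \<open>n\<close> cells of a grid on \<open>[0, L]\<close> contains one interval, whose length is the measure of
  \<open>S\<close> in the cell, shrunk slightly towards \<open>h / 2\<close> so that it fits strictly inside the cell and is
  nonempty.\<close>

lemma config_approximation:
  fixes n :: nat
  assumes S: "S \<in> sets lebesgue" and "0 < L" "2 \<le> n"
  defines "V \<equiv> {..<0} \<union> (S \<inter> {0<..<L})"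
  obtains r a b where "config_data r a b" "config_endpoints r a b \<subseteq> {0..L}"
    "\<And>u v. u \<le> v \<Longrightarrow> \<bar>mes (config r a b) u v - mes V u v\<bar> \<le> 6 * (L / n)"
proof -
  define h where "h = L / n"
  define m where "m i = mes S (real (i - 1) * h) (real i * h)" for i
  define a where "a i = real (i - 1) * h + h / (2 * n)" for i
  \<comment> \<open>As \<open>m i\<close> runs from \<open>0\<close> to \<open>h\<close>, the length
    runs from \<open>h / n\<close> to \<open>h - h / n\<close>. It differs from \<open>m i\<close>
    by at most \<open>h / n\<close>, and with the offset \<open>h / (2 * n)\<close> on the left a
    gap of at least \<open>h / (2 * n)\<close> remains on the right.\<close>
  define b where "b i = a i + (1 - 2 / n) * m i + h / n" for i
  define C where "C = config n a b"
  have n: "0 < real n" "2 \<le> real n" using assms by auto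
  have h: "0 < h" "real n * h = L" using assms by (auto simp: h_def)
  have V: "V \<in> sets lebesgue" unfolding V_def by (intro sets.Un sets.Int S) auto
  have C: "C \<in> sets lebesgue"
    unfolding C_def config_def by (intro sets.Un sets.finite_UN) auto
  have m: "0 \<le> m i" "m i \<le> h" if "1 \<le> i" for i
  proof -
    have "real (i - 1) * h \<le> real i * h" using h by (simp add: mult_right_mono)
    moreover have "real i * h - real (i - 1) * h = h" using that by (simp add: of_nat_diff algebra_simps)
    ultimately show "m i \<le> h" using mes_bounds[OF S, of "real (i - 1) * h" "real i * h"]
      by (simp add: m_def)
  qed (simp add: m_def)
  have a: "real (i - 1) * h < a i" for i using h n by (simp add: a_def)
  have len: "0 < b i - a i" "\<bar>b i - a i - m i\<bar> \<le> h / n" "b i < real i * h" if "1 \<le> i" for i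
  proof -
    have *: "b i - a i = m i - 2 * (m i / n) + h / n" by (simp add: b_def algebra_simps)
    have mn: "0 \<le> m i / n" "m i / n \<le> h / n" using m[OF that] n by (auto simp: divide_right_mono)
    have "0 \<le> (1 - 2 / n) * m i" "(1 - 2 / n) * m i \<le> (1 - 2 / n) * h"
      using m[OF that] n by (auto intro!: mult_nonneg_nonneg mult_left_mono)
    moreover have hn: "0 < h / n" using h n by simp
    ultimately show "0 < b i - a i" by (simp add: b_def)
    show "\<bar>b i - a i - m i\<bar> \<le> h / n" unfolding * using mn by linarith
    have "b i \<le> real (i - 1) * h + h / (2 * n) + (1 - 2 / n) * h + h / n"
      using \<open>(1 - 2 / n) * m i \<le> (1 - 2 / n) * h\<close> by (simp add: b_def a_def)
    also have "\<dots> = real i * h - h / n / 2"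
      using that by (simp add: of_nat_diff algebra_simps)
    also have "\<dots> < real i * h" using hn by simp
    finally show "b i < real i * h" .
  qed
  have cd: "config_data n a b"
    unfolding config_data_def
  proof (intro conjI ballI impI)
    show "0 < a 1" using a[of 1] by simp
    show "a i < b i" if "i \<in> {1..n}" for i using len(1)[of i] that by simp
    show "b i < a (Suc i)" if "i \<in> {1..<n}" for i using len(3)[of i] a[of "Suc i"] that by simp
  qed
  have ep: "config_endpoints n a b \<subseteq> {0..L}"
  proof -
    have "0 \<le> a i \<and> a i \<le> b i \<and> b i \<le> L" if "i \<in> {1..n}" for i
    proof -
      have "real i * h \<le> L" using that h by (metis atLeastAtMost_iff less_imp_le mult_right_mono of_nat_le_iff)
      moreover have "0 \<le> real (i - 1) * h" using h by simp
      ultimately show ?thesis using a[of i] len(1,3)[of i] that by auto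
    qed
    then show ?thesis using assms(2) by (fastforce simp: config_endpoints_def)
  qed
  have cellC: "mes C (real k * h) (real (Suc k) * h) = b (Suc k) - a (Suc k)" if "k < n" for k
  proof -
    have "C \<inter> {real k * h<..<real (Suc k) * h} = {a (Suc k)<..<b (Suc k)}"
    proof (intro set_eqI iffI)
      fix x assume x: "x \<in> C \<inter> {real k * h<..<real (Suc k) * h}"
      have "0 \<le> real k * h" using h by simp
      then have "0 < x" using x by auto
      with x obtain i where i: "i \<in> {1..n}" "a i < x" "x < b i" by (auto simp: C_def config_def)
      have "i = Suc k"
      proof (rule ccontr)
        assume "i \<noteq> Suc k"
        then consider "i \<le> k" | "Suc k \<le> i - 1" by linarith
        then show False
        proof cases
          case 1
          then have "real i * h \<le> real k * h" using h by simp
          then show False using len(3)[of i] i x by auto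
        next
          case 2
          then have "real (Suc k) * h \<le> real (i - 1) * h" using h by (intro mult_right_mono) auto
          then show False using a[of i] i x by auto
        qed
      qed
      with i show "x \<in> {a (Suc k)<..<b (Suc k)}" by simp
    next
      fix x assume "x \<in> {a (Suc k)<..<b (Suc k)}"
      then show "x \<in> C \<inter> {real k * h<..<real (Suc k) * h}"
        using that a[of "Suc k"] len(3)[of "Suc k"] by (force simp: C_def config_def)
    qed
    then show ?thesis using len(1)[of "Suc k"] by simp
  qed
  \<comment> \<open>Each cell contributes an error of at most \<open>h / n\<close>, so over all
    \<open>n\<close> cells the error is at most \<open>h\<close>.\<close>
  have grid: "\<bar>mes C 0 (real k * h) - mes V 0 (real k * h)\<bar> \<le> real k * (h / n)" if "k \<le> n" for k
    using that
  proof (induction k)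
    case (Suc k)
    have k: "0 \<le> real k * h" "real k * h \<le> real (Suc k) * h" using h by (auto intro: mult_right_mono)
    have "real (Suc k) * h \<le> L"
      using Suc h by (metis less_imp_le mult_right_mono of_nat_le_iff)
    with k have "V \<inter> {real k * h<..<real (Suc k) * h} = S \<inter> {real k * h<..<real (Suc k) * h}"
      by (auto simp: V_def)
    then have "mes V (real k * h) (real (Suc k) * h) = m (Suc k)" by (simp add: m_def)
    moreover note Suc mes_add[OF C k] mes_add[OF V k] cellC[of k] len(2)[of "Suc k"]
    ultimately show ?case by (simp add: algebra_simps add_divide_distrib)
  qed simp
  have outside: "mes C x y = 0" "mes V x y = 0" if "L \<le> x" for x y
  proof -
    have "b i \<le> L" if "i \<in> {1..n}" for i using ep that by (force simp: config_endpoints_def)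
    then have "{x<..<y} \<inter> C = {}" using that \<open>0 < L\<close> by (force simp: C_def config_def)
    then show "mes C x y = 0" by (rule mes_empty)
    show "mes V x y = 0" using that \<open>0 < L\<close> by (intro mes_empty) (auto simp: V_def)
  qed
  \<comment> \<open>One \<open>h\<close> is the error at the grid point below \<open>x\<close>;
    moving \<open>x\<close> to that grid point costs one more for each of \<open>C\<close> and
    \<open>V\<close>.\<close>
  have cum: "\<bar>mes C 0 x - mes V 0 x\<bar> \<le> 3 * h" if "0 \<le> x" for x
  proof (cases "x \<le> L")
    case True
    define k where "k = nat \<lfloor>x / h\<rfloor>"
    have k: "real k * h \<le> x" "x \<le> real k * h + h"
    proof -
      have "real k \<le> x / h" "x / h \<le> real k + 1" using that h by (auto simp: k_def)
      then show "real k * h \<le> x" "x \<le> real k * h + h" using h by (auto simp: field_simps)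
    qed
    have "real k * h \<le> real n * h" using k True h by simp
    then have "real k \<le> real n" using h(1) by (rule mult_right_le_imp_le)
    then have kn: "k \<le> n" by simp
    have "real k * (h / n) \<le> real n * (h / n)" using kn h by (intro mult_right_mono) auto
    then have "\<bar>mes C 0 (real k * h) - mes V 0 (real k * h)\<bar> \<le> h" using grid[OF kn] n by simp
    moreover have "\<bar>mes C 0 x - mes C 0 (real k * h)\<bar> \<le> h" "\<bar>mes V 0 x - mes V 0 (real k * h)\<bar> \<le> h"
      using mes_lipschitz[OF C, of 0 x 0 "real k * h"] mes_lipschitz[OF V, of 0 x 0 "real k * h"] k by auto
    ultimately show ?thesis by linarith
  next
    case False
    then have "mes C 0 x = mes C 0 L" "mes V 0 x = mes V 0 L"
      using mes_add[OF C, of 0 L x] mes_add[OF V, of 0 L x] outside \<open>0 < L\<close> by auto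
    moreover have "real n * (h / n) = h" using n by simp
    ultimately show ?thesis using grid[of n] h by simp
  qed
  have cum': "\<bar>mes C z x - mes V z x\<bar> \<le> 3 * h" if "z \<le> x" "z \<le> 0" for z x
  proof (cases "x \<le> 0")
    case True
    have "{z<..<x} \<subseteq> C" "{z<..<x} \<subseteq> V" using True by (auto simp: C_def config_def V_def)
    then show ?thesis using mes_full[of z x C] mes_full[of z x V] that h by simp
  next
    case False
    have "{z<..<0} \<subseteq> C" "{z<..<0} \<subseteq> V" by (auto simp: C_def config_def V_def)
    then show ?thesis
      using mes_full[of z 0 C] mes_full[of z 0 V] that mes_add[OF C, of z 0 x] mes_add[OF V, of z 0 x]
        cum[of x] False by simp
  qed
  \<comment> \<open>The window is the difference of two windows that start at a common
    \<open>z \<le> 0\<close>, each with error at most \<open>3 * h\<close>.\<close>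
  have "\<bar>mes C u v - mes V u v\<bar> \<le> 6 * (L / n)" if "u \<le> v" for u v
  proof -
    define z where "z = min u 0"
    have z: "z \<le> u" "z \<le> 0" "z \<le> v" using that by (auto simp: z_def)
    show ?thesis
      using mes_add[OF C z(1) that] mes_add[OF V z(1) that] cum'[OF z(1,2)] cum'[OF z(3,2)]
      unfolding h_def by linarith
  qed
  then show ?thesis using cd ep unfolding C_def by (intro that)
qed

section \<open>From configurations to nontrivial sets\<close>

text \<open>The approximating configurations have their end points in the compact interval from
  \<open>0\<close> to \<open>L\<close>, and their error is uniform in the scale. So a single limit
  point of good end points serves all \<open>w\<close> at once.\<close>

lemma K_stmt_balanced_point:
  assumes K: "K_stmt \<delta>" and S: "S \<in> sets lebesgue" and "0 < L"
  defines "V \<equiv> {..<0} \<union> (S \<inter> {0<..<L})"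
  obtains p where "0 \<le> p" "p \<le> L"
    "\<And>w. 0 < w \<Longrightarrow> \<delta> * (2 * w) \<le> mes V (p - w) (p + w) \<and> mes V (p - w) (p + w) \<le> (1 - \<delta>) * (2 * w)"
proof -
  have V: "V \<in> sets lebesgue" unfolding V_def by (intro sets.Un sets.Int S) auto
  have "\<exists>c. 0 \<le> c \<and> c \<le> L \<and> (\<forall>w>0. \<delta> * (2 * w) - 6 * (L / real (n + 2)) \<le> mes V (c - w) (c + w) \<and>
      mes V (c - w) (c + w) \<le> (1 - \<delta>) * (2 * w) + 6 * (L / real (n + 2)))" for n
  proof -
    obtain r a b where cd: "config_data r a b" "config_endpoints r a b \<subseteq> {0..L}"
      "\<And>u v. u \<le> v \<Longrightarrow> \<bar>mes (config r a b) u v - mes V u v\<bar> \<le> 6 * (L / real (n + 2))"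
      using config_approximation[OF S \<open>0 < L\<close>, of "n + 2"] unfolding V_def by auto
    obtain c where c: "c \<in> config_endpoints r a b" "\<And>w. 0 < w \<Longrightarrow>
        \<delta> \<le> density_in (config r a b) (nbhd w c) \<and> density_in (config r a b) (nbhd w c) \<le> 1 - \<delta>"
      using K cd(1) unfolding K_stmt_def by blast
    have "\<delta> * (2 * w) - 6 * (L / real (n + 2)) \<le> mes V (c - w) (c + w) \<and>
        mes V (c - w) (c + w) \<le> (1 - \<delta>) * (2 * w) + 6 * (L / real (n + 2))" if "0 < w" for w
    proof -
      have "\<delta> * (2 * w) \<le> mes (config r a b) (c - w) (c + w)"
        "mes (config r a b) (c - w) (c + w) \<le> (1 - \<delta>) * (2 * w)"
        using c(2)[OF that] that by (auto simp: density_in_nbhd pos_le_divide_eq pos_divide_le_eq)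
      then show ?thesis using cd(3)[of "c - w" "c + w"] that by linarith
    qed
    then show ?thesis using c(1) cd(2) by (intro exI[of _ c]) auto
  qed
  then obtain c where c: "\<And>n. c n \<in> {0..L}"
    "\<And>n w. 0 < w \<Longrightarrow> \<delta> * (2 * w) - 6 * (L / real (n + 2)) \<le> mes V (c n - w) (c n + w)"
    "\<And>n w. 0 < w \<Longrightarrow> mes V (c n - w) (c n + w) \<le> (1 - \<delta>) * (2 * w) + 6 * (L / real (n + 2))"
    unfolding atLeastAtMost_iff by metis
  have "compact {0..L}" by simp
  then obtain p f where p: "p \<in> {0..L}" "strict_mono f" "(c \<circ> f) \<longlonglongrightarrow> p"
    using c(1) unfolding compact_def by metis
  show ?thesis
  proof (rule that)
    show "0 \<le> p" "p \<le> L" using p by auto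
    fix w :: real assume w: "0 < w"
    \<comment> \<open>The approximation error plus the Lipschitz cost of moving the centre from
      \<open>c (f n)\<close> to \<open>p\<close>.\<close>
    define e where "e n = 6 * (L / real (f n + 2)) + 2 * \<bar>c (f n) - p\<bar>" for n
    have "(\<lambda>n. c (f n) - p) \<longlonglongrightarrow> 0" using p(3) by (simp add: o_def LIM_zero)
    moreover have "(\<lambda>n. 6 * (L / real (f n + 2))) \<longlonglongrightarrow> 0"
    proof -
      have "(\<lambda>n. 6 * (L / real (n + 2))) \<longlonglongrightarrow> 6 * 0"
        by (intro tendsto_mult tendsto_const LIMSEQ_ignore_initial_segment[OF lim_const_over_n])
      from LIMSEQ_subseq_LIMSEQ[OF this p(2)] show ?thesis by (simp add: o_def)
    qed
    ultimately have "e \<longlonglongrightarrow> 0 + 2 * \<bar>0\<bar>" unfolding e_def by (intro tendsto_add tendsto_mult tendsto_const tendsto_rabs)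
    then have e: "e \<longlonglongrightarrow> 0" by simp
    have *: "\<delta> * (2 * w) - e n \<le> mes V (p - w) (p + w)" "mes V (p - w) (p + w) \<le> (1 - \<delta>) * (2 * w) + e n" for n
    proof -
      have "\<bar>mes V (c (f n) - w) (c (f n) + w) - mes V (p - w) (p + w)\<bar> \<le> 2 * \<bar>c (f n) - p\<bar>"
        using mes_lipschitz[OF V, of "c (f n) - w" "c (f n) + w" "p - w" "p + w"] by simp
      then show "\<delta> * (2 * w) - e n \<le> mes V (p - w) (p + w)"
        "mes V (p - w) (p + w) \<le> (1 - \<delta>) * (2 * w) + e n"
        using c(2,3)[OF w, of "f n"] unfolding e_def by linarith+
    qed
    show "\<delta> * (2 * w) \<le> mes V (p - w) (p + w) \<and> mes V (p - w) (p + w) \<le> (1 - \<delta>) * (2 * w)"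
    proof
      have "(\<lambda>n. \<delta> * (2 * w) - e n) \<longlonglongrightarrow> \<delta> * (2 * w) - 0" by (intro tendsto_intros e)
      then show "\<delta> * (2 * w) \<le> mes V (p - w) (p + w)" using *(1) by (auto intro: LIMSEQ_le_const2)
      have "(\<lambda>n. (1 - \<delta>) * (2 * w) + e n) \<longlonglongrightarrow> (1 - \<delta>) * (2 * w) + 0" by (intro tendsto_intros e)
      then show "mes V (p - w) (p + w) \<le> (1 - \<delta>) * (2 * w)" using *(2) by (auto intro: LIMSEQ_le_const)
    qed
  qed
qed

text \<open>The window from \<open>x\<close> to \<open>y + h\<close> is translated to start at
  \<open>0\<close> and completed by a half-line. Once the balanced point \<open>p\<close> is known
  to be interior, \<open>V\<close> and the translated \<open>S\<close> agree near it. The bounds at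
  small scales, rather than an exceptional point, are stated so that they can be transferred to the
  complement.\<close>

lemma K_stmt_exceptional_between:
  assumes K: "K_stmt \<delta>" and S: "S \<in> sets lebesgue" and "0 < \<delta>" "0 < h" "x < y"
    and dense: "(1 - \<delta>) * h < mes S x (x + h)" and sparse: "mes S y (y + h) < \<delta> * h"
  shows "\<exists>p w0. 0 < w0 \<and> (\<forall>w. 0 < w \<longrightarrow> w < w0 \<longrightarrow>
    \<delta> * (2 * w) \<le> mes S (p - w) (p + w) \<and> mes S (p - w) (p + w) \<le> (1 - \<delta>) * (2 * w))"
proof -
  define L where "L = y + h - x"
  define S0 where "S0 = (+) (- x) ` S"
  define V where "V = {..<0} \<union> (S0 \<inter> {0<..<L})"
  have L: "h < L" "0 < L" using assms by (auto simp: L_def)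
  have S0: "S0 \<in> sets lebesgue" unfolding S0_def by (rule lebesgue_sets_translation[OF S])
  have V: "V \<in> sets lebesgue" unfolding V_def by (intro sets.Un sets.Int S0) auto
  have mem: "z \<in> S \<longleftrightarrow> z - x \<in> S0" for z by (force simp: S0_def image_iff)
  have shift: "mes S (u + x - w) (u + x + w) = mes S0 (u - w) (u + w)" for u w
    using mes_affine[OF S0, of 1 1 "u + x" w S u] mem by (simp add: algebra_simps)
  obtain p where p: "0 \<le> p" "p \<le> L"
    "\<And>w. 0 < w \<Longrightarrow> \<delta> * (2 * w) \<le> mes V (p - w) (p + w) \<and> mes V (p - w) (p + w) \<le> (1 - \<delta>) * (2 * w)"
    using K_stmt_balanced_point[OF K S0 L(2)] unfolding V_def by blast
  have VS0: "mes V u v = mes S0 u v" if "0 \<le> u" "v \<le> L" for u v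
  proof -
    have "V \<inter> {u<..<v} = S0 \<inter> {u<..<v}" using that by (auto simp: V_def)
    then show ?thesis by simp
  qed
  have \<delta>h: "0 < \<delta> * h" using assms by simp
  \<comment> \<open>At scale \<open>h\<close> about \<open>0\<close> the half-line contributes
    \<open>h\<close> and the dense window more than \<open>(1 - \<delta>) * h\<close>, which exceeds
    \<open>(1 - \<delta>) * (2 * h)\<close>.\<close>
  have "p \<noteq> 0"
  proof
    assume "p = 0"
    have "mes V (- h) 0 = 0 - (- h)" by (rule mes_full) (use \<open>0 < h\<close> in \<open>auto simp: V_def\<close>)
    then have "mes V (- h) h = h + mes S0 0 h"
      using mes_add[OF V, of "- h" 0 h] VS0[of 0 h] L \<open>0 < h\<close> by simp
    moreover have "mes S0 0 h = mes S x (x + h)" using shift[of "h / 2" "h / 2"] by (simp add: add.commute)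
    moreover have "mes V (- h) h \<le> (1 - \<delta>) * (2 * h)" using p(3)[OF \<open>0 < h\<close>] \<open>p = 0\<close> by simp
    ultimately show False using dense \<delta>h by (simp add: algebra_simps)
  qed
  \<comment> \<open>At scale \<open>h\<close> about \<open>L\<close> only the sparse window
    contributes, less than \<open>\<delta> * h\<close>.\<close>
  have "p \<noteq> L"
  proof
    assume "p = L"
    have "mes V L (L + h) = 0" by (rule mes_empty) (use L in \<open>auto simp: V_def\<close>)
    then have "mes V (L - h) (L + h) = mes S0 (L - h) L"
      using mes_add[OF V, of "L - h" L "L + h"] VS0[of "L - h" L] L \<open>0 < h\<close> by simp
    moreover have "mes S0 (L - h) L = mes S y (y + h)"
      using shift[of "L - h / 2" "h / 2"] by (simp add: L_def algebra_simps)
    moreover have "\<delta> * (2 * h) \<le> mes V (L - h) (L + h)" using p(3)[OF \<open>0 < h\<close>] \<open>p = L\<close> by simp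
    ultimately show False using sparse \<delta>h by (simp add: algebra_simps)
  qed
  show ?thesis
  proof (intro exI conjI allI impI)
    show "0 < min p (L - p)" using p \<open>p \<noteq> 0\<close> \<open>p \<noteq> L\<close> by auto
    fix w assume "0 < w" "w < min p (L - p)"
    then have "mes S (p + x - w) (p + x + w) = mes V (p - w) (p + w)"
      using shift[of p w] VS0[of "p - w" "p + w"] by simp
    with p(3)[OF \<open>0 < w\<close>]
    show "\<delta> * (2 * w) \<le> mes S (p + x - w) (p + x + w)"
      "mes S (p + x - w) (p + x + w) \<le> (1 - \<delta>) * (2 * w)" by auto
  qed
qed

lemma K_imp_H:
  assumes K: "K_stmt \<delta>" and "0 < \<delta>"
  shows "H_stmt \<delta>"
  unfolding H_stmt_def
proof (intro allI impI)
  fix S assume nt: "nontrivial S"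
  then have S: "S \<in> sets lebesgue" by (simp add: nontrivial_def)
  then have S': "- S \<in> sets lebesgue" using sets.compl_sets[OF S] by (simp add: Compl_eq_Diff_UNIV)
  \<comment> \<open>The cap \<open>1/2\<close> excludes \<open>x = y\<close>, since one window
    cannot be both dense and sparse at that threshold.\<close>
  define \<theta> where "\<theta> = min \<delta> (1/2)"
  have \<theta>: "0 < \<theta>" "\<theta> \<le> \<delta>" "\<theta> \<le> 1/2" using \<open>0 < \<delta>\<close> by (auto simp: \<theta>_def)
  obtain x y h where h: "0 < h" "(1 - \<theta>) * h < mes S x (x + h)" "mes S y (y + h) < \<theta> * h"
    using nontrivial_dense_sparse_intervals[OF nt \<theta>(1)] by blast
  have \<theta>h: "\<theta> * h \<le> \<delta> * h" "\<theta> * h \<le> h / 2" using \<theta> h mult_right_mono[of \<theta> "1/2" h] by auto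
  then have \<delta>: "(1 - \<delta>) * h < mes S x (x + h)" "mes S y (y + h) < \<delta> * h"
    using h(2,3) by (simp_all add: algebra_simps)
  show "\<exists>p. exceptional_point \<delta> S p"
  proof (cases x y rule: linorder_cases)
    case less
    then show ?thesis
      using K_stmt_exceptional_between[OF K S \<open>0 < \<delta>\<close> h(1) less \<delta>] exceptional_pointI by blast
  next
    case equal
    then show ?thesis using h(2,3) \<theta>h by (simp add: algebra_simps)
  next
    case greater
    \<comment> \<open>If the sparse window comes first, the complement has the required order, and
      the two-sided bound is invariant under complements.\<close>
    have "(1 - \<delta>) * h < mes (- S) y (y + h)" "mes (- S) x (x + h) < \<delta> * h"
      using mes_compl[OF S, of y "y + h"] mes_compl[OF S, of x "x + h"] h(1) \<delta>
      by (simp_all add: algebra_simps)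
    from K_stmt_exceptional_between[OF K S' \<open>0 < \<delta>\<close> h(1) greater this]
    obtain p w0 where "0 < w0" and p: "\<And>w. 0 < w \<Longrightarrow> w < w0 \<Longrightarrow>
        \<delta> * (2 * w) \<le> mes (- S) (p - w) (p + w) \<and> mes (- S) (p - w) (p + w) \<le> (1 - \<delta>) * (2 * w)"
      by blast
    have "exceptional_point \<delta> S p"
    proof (rule exceptional_pointI[OF \<open>0 < w0\<close>])
      fix w assume "0 < w" "w < w0"
      with p[of w] mes_compl[OF S, of "p - w" "p + w"]
      show "\<delta> * (2 * w) \<le> mes S (p - w) (p + w) \<and> mes S (p - w) (p + w) \<le> (1 - \<delta>) * (2 * w)"
        by (simp add: algebra_simps)
    qed
    then show ?thesis ..
  qed
qed

theorem proposition2: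
  shows "delta_H = delta_K"
proof -
  let ?H = "{\<delta>. 0 \<le> \<delta> \<and> \<delta> \<le> 1/2 \<and> H_stmt \<delta>}" and ?K = "{\<delta>. 0 < \<delta> \<and> \<delta> \<le> 1/2 \<and> K_stmt \<delta>}"
  have bdd: "bdd_above ?H" "bdd_above ?K" by (auto intro!: bdd_aboveI[of _ "1/2"])
  have K0: "1/16 \<in> ?K" using H_imp_K[OF H_stmt_eighth, of "1/16"] by simp
  have "Sup ?K \<le> Sup ?H"
  proof (rule cSup_subset_mono)
    show "?K \<noteq> {}" using K0 by blast
    show "?K \<subseteq> ?H" using K_imp_H by auto
  qed (rule bdd)
  moreover have "Sup ?H \<le> Sup ?K"
  proof (rule cSup_least)
    show "?H \<noteq> {}" using H_stmt_eighth by (intro ex_in_conv[THEN iffD1] exI[of _ "1/8"]) simp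
    fix \<delta> assume \<delta>: "\<delta> \<in> ?H"
    show "\<delta> \<le> Sup ?K"
    \<comment> \<open>\<open>H_imp_K\<close> yields only values strictly below
      \<open>\<delta>\<close>, so \<open>\<delta>\<close> is approached from below. Values
      \<open>\<delta>' \<le> 0\<close> lie outside \<open>?K\<close> and are compared with
      \<open>1/16\<close> instead.\<close>
    proof (rule dense_le)
      fix \<delta>' assume "\<delta>' < \<delta>"
      show "\<delta>' \<le> Sup ?K"
      proof (cases "0 < \<delta>'")
        case True
        then have "\<delta>' \<in> ?K" using \<delta> \<open>\<delta>' < \<delta>\<close> H_imp_K by auto
        then show ?thesis using bdd(2) by (rule cSup_upper)
      next
        case False
        then show ?thesis using cSup_upper[OF K0 bdd(2)] by simp
      qed
    qed
  qed
  ultimately show ?thesis unfolding delta_H_def delta_K_def by simp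
qed

end
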